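(* Let $n\geq 2$ and $d\geq 3$ be integers. Then $fmp(G(d^n,d))=3$ if $(n,d)=(2,3)$ and $fmp(G(d^n,d))=2n$ otherwise; and $fsmp(G(d^n,d))=3$ if $(n,d)\in\{(2,3),(2,4)\}$ and $fsmp(G(d^n,d))=2n$ otherwise.
   Context: The recursive circulant graph $G(d^n,d)$ has vertex set $\{0,1,\dots,d^n-1\}$, with $u,v$ adjacent iff $u-v\equiv \pm d^i\pmod{d^n}$ for some $0\leq i\leq n-1$. A fractional perfect matching of $G$ is $g:E(G)\to[0,1]$ with $\sum_{e\ni v}g(e)=1$ for all $v$. $fmp(G)$ (resp. $fsmp(G)$) is the minimum size of a set $F\subseteq E(G)$ (resp. $F\subseteq V(G)\cup E(G)$) whose deletion (vertices with incident edges, and edges) leaves a graph with no fractional perfect matching. *)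

theory Defs
  imports Complex_Main "HOL-Number_Theory.Cong"
begin

text \<open>
  A graph is a pair of a vertex set and a set of edges, each edge being the set of its endpoints.
\<close>

type_synonym 'a ugraph = "'a set \<times> 'a set set"

definition verts :: "'a ugraph \<Rightarrow> 'a set" where
  "verts G = fst G"

definition edges :: "'a ugraph \<Rightarrow> 'a set set" where
  "edges G = snd G"

text \<open>
  The recursive circulant graph $G(d^n,d)$. For $d \geq 2$ there are no loops, because $d^i$ is
  not divisible by $d^n$ when $i < n$.
\<close>

definition recursive_circulant :: "nat \<Rightarrow> nat \<Rightarrow> int ugraph" where
  "recursive_circulant n d =
     ({0..<int d ^ n},
      {{u, v} | u v. u \<in> {0..<int d ^ n} \<and> v \<in> {0..<int d ^ n} \<and>
         (\<exists>i<n. [u - v = int d ^ i] (mod (int d ^ n)) \<or>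
                [u - v = - (int d ^ i)] (mod (int d ^ n)))})"

text \<open>
  Meant for finite graphs: a vertex of infinite degree would have sum 0. Values of \<open>g\<close> outside
  the edge set are irrelevant. The graph without vertices has a fractional perfect matching.
\<close>

definition fractional_perfect_matching :: "'a ugraph \<Rightarrow> ('a set \<Rightarrow> real) \<Rightarrow> bool" where
  "fractional_perfect_matching G g \<longleftrightarrow>
     (\<forall>e\<in>edges G. 0 \<le> g e \<and> g e \<le> 1) \<and>
     (\<forall>v\<in>verts G. (\<Sum>e\<in>{e \<in> edges G. v \<in> e}. g e) = 1)"

definition has_fractional_perfect_matching :: "'a ugraph \<Rightarrow> bool" where
  "has_fractional_perfect_matching G \<longleftrightarrow> (\<exists>g. fractional_perfect_matching G g)"

definition delete_edges :: "'a ugraph \<Rightarrow> 'a set set \<Rightarrow> 'a ugraph" where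
  "delete_edges G F = (verts G, edges G - F)"

definition delete_verts :: "'a ugraph \<Rightarrow> 'a set \<Rightarrow> 'a ugraph" where
  "delete_verts G A = (verts G - A, {e \<in> edges G. e \<inter> A = {}})"

text \<open>
  A mixed set of vertices and edges is a subset of the disjoint sum of the two sets, with
  \<open>Inl\<close> marking vertices and \<open>Inr\<close> marking edges. It may contain an edge together with an
  endpoint of that edge; both then count towards its size.
\<close>

definition delete_mixed :: "'a ugraph \<Rightarrow> ('a + 'a set) set \<Rightarrow> 'a ugraph" where
  "delete_mixed G F = delete_verts (delete_edges G (Inr -` F)) (Inl -` F)"

text \<open>
  The minima below are infima in \<open>nat\<close>, hence attained whenever a precluding set exists; for a
  graph without one the value is the junk value \<open>Inf {} = 0\<close>. It cannot be confused with a
  positive value.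
\<close>

definition fmp :: "'a ugraph \<Rightarrow> nat" where
  "fmp G = Inf {card F | F. finite F \<and> F \<subseteq> edges G \<and>
                  \<not> has_fractional_perfect_matching (delete_edges G F)}"

definition fsmp :: "'a ugraph \<Rightarrow> nat" where
  "fsmp G = Inf {card F | F. finite F \<and> F \<subseteq> verts G <+> edges G \<and>
                   \<not> has_fractional_perfect_matching (delete_mixed G F)}"

end

theory Submission
  imports Defs
begin

text \<open>
  By Hall's theorem in the bipartite double cover, a graph without fractional perfect matching has
  an independent set \<open>I\<close> with fewer than \<open>card I\<close> neighbours. If deleting \<open>F\<close> from the circulant
  creates such an \<open>I\<close>, then \<open>F\<close> pays for every vertex of the original closed neighbourhood \<open>N[I]\<close>
  that is lost and contains every edge inside \<open>I\<close>; so it suffices to bound \<open>|N[X]| + e(X) - 2|X|\<close>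
  from below by \<open>2n - 1\<close> for all nonempty \<open>X\<close>. Summing this quantity over the residue classes
  modulo \<open>d\<close> reduces the bound for \<open>n + 1\<close> to the one for \<open>n\<close>, and for that the weaker bound 2,
  which is what remains true for \<open>n = 2\<close> and \<open>d \<le> 4\<close>, is a sufficient start. For \<open>n = 2\<close> the
  quantity is expressed by the arcs of a single type, and edge-disjoint odd cycles give the bound.
\<close>

section \<open>Hall's theorem and fractional perfect matchings\<close>

text \<open>The induction cannot start at \<open>n = 1\<close>. There the circulant is a cycle, and
  the quantity is 0 when \<open>X\<close> is every second vertex (with one adjacent pair if
  \<open>d\<close> is odd); the step turns a bound \<open>b\<close> into at most
  \<open>min (3 * b) (2 * b + 1)\<close> and gains too little from 0. The exceptional pairs come
  from counting cycles. If for \<open>n = 2\<close> the quantity were at most \<open>t\<close>, at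
  most \<open>2 * t\<close> arcs would have to meet \<open>d\<close> edge-disjoint odd cycles, so
  the desired \<open>t = 2\<close> needs \<open>d \<ge> 5\<close>, while \<open>d = 3\<close> and
  \<open>d = 4\<close> only allow \<open>t = 1\<close>. These two cases then part. For
  \<open>d = 3\<close> three edges do preclude. For \<open>d = 4\<close> a barrier using up all 16
  vertices has even excess, so edges alone must pay for an excess of 2, whereas deleting one vertex
  on the smaller side reaches excess 2 from a balanced partition; hence \<open>fmp\<close> needs an
  argument of its own there. The upper bound \<open>2 * n\<close> is the degree: isolating a vertex
  precludes.\<close>

lemma hall_marriage:
  fixes N :: "'a \<Rightarrow> 'b set"
  assumes "finite X" and "\<And>x. x \<in> X \<Longrightarrow> finite (N x)"
    and "\<And>J. J \<subseteq> X \<Longrightarrow> card J \<le> card (\<Union>(N ` J))"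
  shows "\<exists>f. inj_on f X \<and> (\<forall>x\<in>X. f x \<in> N x)"
  using assms
proof (induction "card X" arbitrary: X N rule: less_induct)
  case less
  note fin = less.prems(1) and finN = less.prems(2) and hall = less.prems(3)
  show ?case
  proof (cases "X = {}")
    case False
    show ?thesis
    \<comment> \<open>A tight set \<open>J\<close> uses up all of its neighbourhood
      \<open>M\<close>, and what remains after removing both still satisfies Hall's condition.
      Without tight proper subsets every such set has a neighbour to spare, so one pair may be
      matched arbitrarily.\<close>
    proof (cases "\<exists>J. J \<subset> X \<and> J \<noteq> {} \<and> card (\<Union>(N ` J)) = card J")
      case True
      then obtain J where J: "J \<subset> X" "J \<noteq> {}" "card (\<Union>(N ` J)) = card J" by blast
      have finJ: "finite J" using J(1) fin finite_subset by blast
      define M where "M = \<Union>(N ` J)"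
      have finM: "finite M" unfolding M_def using finJ finN J(1) by blast
      have "\<exists>f. inj_on f J \<and> (\<forall>x\<in>J. f x \<in> N x)"
        using less.hyps[of J N] J fin finJ finN hall by (meson dual_order.trans psubsetE psubset_card_mono subsetD)
      then obtain f where f: "inj_on f J" "\<forall>x\<in>J. f x \<in> N x" by blast
      have "\<exists>h. inj_on h (X - J) \<and> (\<forall>x\<in>X - J. h x \<in> N x - M)"
      proof (rule less.hyps)
        show "card (X - J) < card X"
          using J fin by (intro psubset_card_mono) auto
        show "finite (X - J)" using fin by simp
        show "finite (N x - M)" if "x \<in> X - J" for x using finN that by blast
        show "card K \<le> card (\<Union>x\<in>K. N x - M)" if K: "K \<subseteq> X - J" for K
        proof -
          have finK: "finite K" using K fin finite_subset by blast
          have "card J + card K = card (J \<union> K)"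
            using K by (intro card_Un_disjoint[OF finJ finK, symmetric]) blast
          also have "\<dots> \<le> card (\<Union>(N ` (J \<union> K)))" using hall[of "J \<union> K"] K J by blast
          also have "\<Union>(N ` (J \<union> K)) = M \<union> (\<Union>x\<in>K. N x - M)" unfolding M_def by blast
          also have "card \<dots> \<le> card M + card (\<Union>x\<in>K. N x - M)" by (rule card_Un_le)
          finally show ?thesis using J(3) M_def by simp
        qed
      qed
      then obtain h where h: "inj_on h (X - J)" "\<forall>x\<in>X - J. h x \<in> N x - M" by blast
      define k where "k x = (if x \<in> J then f x else h x)" for x
      have "inj_on k X"
      proof (rule inj_onI)
        fix x y assume xy: "x \<in> X" "y \<in> X" "k x = k y"
        have fM: "f z \<in> M" if "z \<in> J" for z using f(2) that unfolding M_def by blast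
        show "x = y"
          using xy fM h f(1) unfolding k_def inj_on_def by (metis Diff_iff)
      qed
      moreover have "\<forall>x\<in>X. k x \<in> N x" unfolding k_def using f(2) h(2) by auto
      ultimately show ?thesis by blast
    next
      case nt: False
      obtain x where x: "x \<in> X" using False by blast
      have "N x \<noteq> {}" using hall[of "{x}"] x by auto
      then obtain y where y: "y \<in> N x" by blast
      have "\<exists>f. inj_on f (X - {x}) \<and> (\<forall>z\<in>X - {x}. f z \<in> N z - {y})"
      proof (rule less.hyps)
        show "card (X - {x}) < card X" using x fin by (meson card_Diff1_less)
        show "finite (X - {x})" using fin by simp
        show "finite (N z - {y})" if "z \<in> X - {x}" for z using finN that by blast
        show "card K \<le> card (\<Union>z\<in>K. N z - {y})" if K: "K \<subseteq> X - {x}" for K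
        proof (cases "K = {}")
          case False
          have "K \<subset> X" using K x by blast
          then have "card K < card (\<Union>(N ` K))"
            using nt False hall[of K] by (metis le_neq_implies_less psubset_imp_subset)
          moreover have "(\<Union>z\<in>K. N z - {y}) = \<Union>(N ` K) - {y}" by blast
          ultimately show ?thesis by (auto simp: card_Diff_singleton_if)
        qed simp
      qed
      then obtain f where f: "inj_on f (X - {x})" "\<forall>z\<in>X - {x}. f z \<in> N z - {y}" by blast
      have "inj_on (f(x := y)) X" using f unfolding inj_on_def by auto
      moreover have "\<forall>z\<in>X. (f(x := y)) z \<in> N z" using f(2) y by auto
      ultimately show ?thesis by blast
    qed
  qed simp
qed

text \<open>Half the indicator of each \<open>{v, \<sigma> v}\<close> is a fractional perfect matching when \<open>\<sigma>\<close> is a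
  permutation along edges; Hall's condition in the bipartite double cover provides \<open>\<sigma>\<close>.\<close>

lemma fractional_perfect_matching_from_hall:
  assumes fin: "finite (verts G)"
    and wf: "\<And>e. e \<in> edges G \<Longrightarrow> \<exists>u v. u \<in> verts G \<and> v \<in> verts G \<and> u \<noteq> v \<and> e = {u, v}"
    and hall: "\<And>J. J \<subseteq> verts G \<Longrightarrow> card J \<le> card {v \<in> verts G. \<exists>u\<in>J. {u, v} \<in> edges G}"
  shows "has_fractional_perfect_matching G"
proof -
  define V where "V = verts G"
  define E where "E = edges G"
  have finE: "finite E"
  proof (rule finite_subset)
    show "E \<subseteq> Pow V" unfolding E_def V_def using wf by blast
  qed (simp add: V_def fin)
  have "\<exists>f. inj_on f V \<and> (\<forall>x\<in>V. f x \<in> {v \<in> V. {x, v} \<in> E})"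
  proof (rule hall_marriage)
    show "card J \<le> card (\<Union>u\<in>J. {v \<in> V. {u, v} \<in> E})" if "J \<subseteq> V" for J
    proof -
      have "(\<Union>u\<in>J. {v \<in> V. {u, v} \<in> E}) = {v \<in> verts G. \<exists>u\<in>J. {u, v} \<in> edges G}"
        unfolding V_def E_def by blast
      then show ?thesis using hall[of J] that V_def by simp
    qed
  qed (simp_all add: V_def fin)
  then obtain \<sigma> where inj: "inj_on \<sigma> V" and \<sigma>: "\<And>x. x \<in> V \<Longrightarrow> \<sigma> x \<in> V" "\<And>x. x \<in> V \<Longrightarrow> {x, \<sigma> x} \<in> E"
    by blast
  have surj: "\<sigma> ` V = V"
    using endo_inj_surj[of V \<sigma>] inj \<sigma>(1) fin V_def by blast
  have neq: "\<sigma> x \<noteq> x" if "x \<in> V" for x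
  proof
    assume "\<sigma> x = x"
    then have "{x} \<in> edges G" using \<sigma>(2)[OF that] E_def by simp
    from wf[OF this] show False by (metis insertI1 insert_commute singletonD)
  qed
  define g where "g e = real (card {v \<in> V. {v, \<sigma> v} = e}) / 2" for e
  have "fractional_perfect_matching G g"
    unfolding fractional_perfect_matching_def
  proof (intro conjI ballI)
    fix e assume e: "e \<in> edges G"
    then obtain u v where uv: "e = {u, v}" using wf by blast
    have "card {w \<in> V. {w, \<sigma> w} = e} \<le> card {u, v}"
      by (rule card_mono) (auto simp: uv)
    also have "\<dots> \<le> 2" by (simp add: card_insert_if)
    finally show "g e \<le> 1" unfolding g_def by simp
  next
    fix e show "0 \<le> g e" unfolding g_def by simp
  next
    fix v assume "v \<in> verts G"
    then have v: "v \<in> V" by (simp add: V_def)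
    then have "v \<in> \<sigma> ` V" using surj by simp
    then obtain w where w: "w \<in> V" "\<sigma> w = v" by blast
    have "(\<Sum>e\<in>{e \<in> E. v \<in> e}. card {x \<in> V. {x, \<sigma> x} = e}) =
          card (\<Union>e\<in>{e \<in> E. v \<in> e}. {x \<in> V. {x, \<sigma> x} = e})"
      by (rule card_UN_disjoint[symmetric]) (use finE fin V_def in auto)
    \<comment> \<open>Exactly two halves meet at \<open>v\<close>: one from \<open>v\<close> itself
      and one from its preimage \<open>w\<close>. If both lie on the same edge, that edge has weight
      1.\<close>
    also have "(\<Union>e\<in>{e \<in> E. v \<in> e}. {x \<in> V. {x, \<sigma> x} = e}) = {v, w}"
    proof -
      have "x = w" if "x \<in> V" "\<sigma> x = v" for x using that w inj by (simp add: inj_on_def)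
      then show ?thesis using v w \<sigma>(2) by blast
    qed
    also have "card {v, w} = 2" using neq[OF w(1)] w(2) by (auto simp: card_insert_if)
    finally have "(\<Sum>e\<in>{e \<in> E. v \<in> e}. card {x \<in> V. {x, \<sigma> x} = e}) = 2" .
    then have "(\<Sum>e\<in>{e \<in> E. v \<in> e}. real (card {x \<in> V. {x, \<sigma> x} = e})) = 2"
      by (simp flip: of_nat_sum)
    then show "(\<Sum>e\<in>{e \<in> edges G. v \<in> e}. g e) = 1"
      unfolding g_def E_def by (simp flip: sum_divide_distrib)
  qed
  then show ?thesis unfolding has_fractional_perfect_matching_def by blast
qed

text \<open>A violator \<open>X\<close> of Hall's condition in the double cover need not be
  independent. Removing \<open>X \<inter> N X\<close> from both \<open>X\<close> and
  \<open>N X\<close> keeps the deficiency, and a neighbour of a vertex of \<open>X - N X\<close>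
  cannot lie in \<open>X\<close>, since it would put that vertex into \<open>N X\<close>.\<close>

lemma no_fractional_perfect_matching_barrier:
  assumes fin: "finite (verts G)"
    and wf: "\<And>e. e \<in> edges G \<Longrightarrow> \<exists>u v. u \<in> verts G \<and> v \<in> verts G \<and> u \<noteq> v \<and> e = {u, v}"
    and no: "\<not> has_fractional_perfect_matching G"
  obtains I S where "I \<subseteq> verts G" "S \<subseteq> verts G" "I \<inter> S = {}" "card S < card I"
    "\<And>u v. u \<in> I \<Longrightarrow> {u, v} \<in> edges G \<Longrightarrow> v \<in> S"
proof -
  define N where "N J = {v \<in> verts G. \<exists>u\<in>J. {u, v} \<in> edges G}" for J
  have "\<not> (\<forall>X. X \<subseteq> verts G \<longrightarrow> card X \<le> card (N X))"
  proof
    assume "\<forall>X. X \<subseteq> verts G \<longrightarrow> card X \<le> card (N X)"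
    then have "has_fractional_perfect_matching G"
      by (intro fractional_perfect_matching_from_hall[OF fin wf]) (auto simp: N_def)
    then show False using no by contradiction
  qed
  then obtain X where X: "X \<subseteq> verts G" "card (N X) < card X" by (meson not_le)
  have finX: "finite X" using X fin finite_subset by blast
  have finN: "finite (N X)" unfolding N_def using fin by simp
  have vs: "v \<in> verts G" if "{u, v} \<in> edges G" for u v
    using wf[OF that] by (metis doubleton_eq_iff)
  show thesis
  proof (rule that[of "X - N X" "N X - X"])
    show "card (N X - X) < card (X - N X)"
      by (rule card_less_sym_Diff[OF finN finX X(2)])
    show "v \<in> N X - X" if "u \<in> X - N X" "{u, v} \<in> edges G" for u v
    proof -
      have "{v, u} \<in> edges G" using that(2) by (simp add: insert_commute)
      then have "v \<notin> X" using that vs[of v u] unfolding N_def by blast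
      then show ?thesis using that vs[of u v] unfolding N_def by blast
    qed
  qed (use X(1) N_def in auto)
qed

text \<open>Double counting: the weights at the vertices of a set \<open>A\<close> sum to
  \<open>card A\<close>, and edge \<open>e\<close> contributes
  \<open>card (e \<inter> A) * g e\<close>. Comparing \<open>I\<close> and \<open>S\<close> edge by
  edge serves both an isolated vertex and a partition of all vertices.\<close>

lemma barrier_no_fractional_perfect_matching:
  assumes finE: "finite (edges G)" and finI: "finite I" and finS: "finite S"
    and sub: "I \<subseteq> verts G" "S \<subseteq> verts G"
    and le: "\<And>e. e \<in> edges G \<Longrightarrow> card (e \<inter> I) \<le> card (e \<inter> S)"
    and less: "card S < card I"
  shows "\<not> has_fractional_perfect_matching G"
proof
  assume "has_fractional_perfect_matching G"
  then obtain g where g: "fractional_perfect_matching G g"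
    unfolding has_fractional_perfect_matching_def by blast
  have nonneg: "0 \<le> g e" if "e \<in> edges G" for e
    using g that unfolding fractional_perfect_matching_def by blast
  have one: "(\<Sum>e\<in>{e \<in> edges G. v \<in> e}. g e) = 1" if "v \<in> verts G" for v
    using g that unfolding fractional_perfect_matching_def by blast
  have count: "real (card A) = (\<Sum>e\<in>edges G. real (card (e \<inter> A)) * g e)"
    if A: "finite A" "A \<subseteq> verts G" for A
  proof -
    have "real (card A) = (\<Sum>v\<in>A. \<Sum>e\<in>{e \<in> edges G. v \<in> e}. g e)"
      using one A(2) by (simp add: subset_iff)
    also have "\<dots> = (\<Sum>e\<in>edges G. \<Sum>v\<in>{v \<in> A. v \<in> e}. g e)"
      by (rule sum.swap_restrict[OF A(1) finE])
    also have "\<dots> = (\<Sum>e\<in>edges G. real (card (e \<inter> A)) * g e)"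
      by (rule sum.cong) (auto simp: Int_def conj_commute)
    finally show ?thesis .
  qed
  have "real (card I) \<le> real (card S)"
    unfolding count[OF finI sub(1)] count[OF finS sub(2)]
    by (rule sum_mono) (use le nonneg in \<open>auto intro: mult_right_mono\<close>)
  then show False using less by simp
qed

section \<open>Expansion in recursive circulants\<close>

text \<open>Orients the circulant: the pair of \<open>x\<close> and \<open>shift d n i x\<close> is
  the arc of type \<open>i\<close> leaving \<open>x\<close>. For \<open>d > 0\<close> each type is a
  permutation of the vertices, which makes arcs easier to count than edges.\<close>

definition shift :: "int \<Rightarrow> nat \<Rightarrow> nat \<Rightarrow> int \<Rightarrow> int" where
  "shift d n i x = (x + d ^ i) mod d ^ n"

definition closed_nbhd :: "int \<Rightarrow> nat \<Rightarrow> int set \<Rightarrow> int set" where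
  "closed_nbhd d n X =
     {y \<in> {0..<d ^ n}. y \<in> X \<or> (\<exists>i<n. shift d n i y \<in> X \<or> y \<in> shift d n i ` X)}"

text \<open>This is \<open>e(X)\<close> of the overview: for \<open>d \<ge> 3\<close> and
  \<open>X\<close> a set of vertices, arcs and edges correspond one to one, see
  \<open>inj_on_arc_edge\<close>.\<close>

definition inner_arcs :: "int \<Rightarrow> nat \<Rightarrow> int set \<Rightarrow> nat" where
  "inner_arcs d n X = (\<Sum>i<n. card {x \<in> X. shift d n i x \<in> X})"

lemma finite_closed_nbhd: "finite (closed_nbhd d n X)"
  by (rule finite_subset[of _ "{0..<d ^ n}"]) (auto simp: closed_nbhd_def)

lemma mod_eq_imp_eq:
  fixes a b N :: int
  assumes "a mod N = b mod N" "\<bar>a - b\<bar> < N"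
  shows "a = b"
proof -
  have "N dvd a - b" using assms(1) by (simp add: mod_eq_dvd_iff)
  then show ?thesis using assms(2) zdvd_imp_le[of N "a - b"] zdvd_imp_le[of N "b - a"]
    by (smt (verit) dvd_minus_iff minus_diff_eq)
qed

lemma bij_betw_add_mod:
  fixes c N :: int
  assumes "N > 0"
  shows "bij_betw (\<lambda>x. (x + c) mod N) {0..<N} {0..<N}"
proof (rule bij_betw_byWitness[where f' = "\<lambda>x. (x - c) mod N"])
  show "\<forall>x\<in>{0..<N}. ((x + c) mod N - c) mod N = x"
    by (auto simp: mod_simps)
  show "\<forall>x\<in>{0..<N}. ((x - c) mod N + c) mod N = x"
    by (auto simp: mod_simps)
qed (use assms in auto)

lemma bij_betw_shift: "d > 0 \<Longrightarrow> bij_betw (shift d n i) {0..<d ^ n} {0..<d ^ n}"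
  unfolding shift_def by (rule bij_betw_add_mod) simp

lemma shift_in: "d > 0 \<Longrightarrow> shift d n i x \<in> {0..<d ^ n}"
  by (simp add: shift_def)

section \<open>Arc counts of a permutation between three parts\<close>

lemma card_split3:
  assumes "finite A" "f ` A \<subseteq> X \<union> S \<union> Q" "X \<inter> S = {}" "X \<inter> Q = {}" "S \<inter> Q = {}"
  shows "card A = card {x \<in> A. f x \<in> X} + card {x \<in> A. f x \<in> S} + card {x \<in> A. f x \<in> Q}"
proof -
  have "A = ({x \<in> A. f x \<in> X} \<union> {x \<in> A. f x \<in> S}) \<union> {x \<in> A. f x \<in> Q}"
    using assms(2) by blast
  also have "card \<dots> = card ({x \<in> A. f x \<in> X} \<union> {x \<in> A. f x \<in> S}) + card {x \<in> A. f x \<in> Q}"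
    by (rule card_Un_disjoint) (use assms in auto)
  also have "card ({x \<in> A. f x \<in> X} \<union> {x \<in> A. f x \<in> S}) =
      card {x \<in> A. f x \<in> X} + card {x \<in> A. f x \<in> S}"
    by (rule card_Un_disjoint) (use assms in auto)
  finally show ?thesis .
qed

lemma card_vimage_perm:
  assumes "bij_betw f V V" "X \<subseteq> V"
  shows "card {x \<in> V. f x \<in> X} = card X"
proof -
  have "f ` {x \<in> V. f x \<in> X} = X" using assms unfolding bij_betw_def by auto
  moreover have "inj_on f {x \<in> V. f x \<in> X}"
    using assms(1) unfolding bij_betw_def by (auto intro: inj_on_subset)
  ultimately show ?thesis using card_image by metis
qed

lemma card_vimage_split3:
  assumes "finite V" "bij_betw f V V" "V = X \<union> S \<union> Q" "X \<inter> S = {}" "X \<inter> Q = {}" "S \<inter> Q = {}"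
    "Y \<subseteq> V"
  shows "card Y = card {x \<in> X. f x \<in> Y} + card {x \<in> S. f x \<in> Y} + card {x \<in> Q. f x \<in> Y}"
proof -
  let ?P = "{x \<in> V. f x \<in> Y}"
  have "card Y = card ?P" using card_vimage_perm[OF assms(2,7)] by simp
  also have "\<dots> = card {x \<in> ?P. x \<in> X} + card {x \<in> ?P. x \<in> S} + card {x \<in> ?P. x \<in> Q}"
    by (rule card_split3) (use assms in auto)
  also have "{x \<in> ?P. x \<in> X} = {x \<in> X. f x \<in> Y}" using assms(3) by blast
  also have "{x \<in> ?P. x \<in> S} = {x \<in> S. f x \<in> Y}" using assms(3) by blast
  also have "{x \<in> ?P. x \<in> Q} = {x \<in> Q. f x \<in> Y}" using assms(3) by blast
  finally show ?thesis .
qed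

text \<open>Compare the arcs leaving \<open>S\<close> with the arcs entering \<open>X\<close>: those
  from \<open>S\<close> to \<open>X\<close> occur in both counts and cancel. With \<open>S\<close>
  and \<open>Q\<close> the outer neighbourhood of \<open>X\<close> and the rest,
  \<open>card S - card X\<close> becomes an arc count of one type.\<close>

lemma perm_balance:
  assumes fin: "finite V" and bij: "bij_betw f V V" and V: "V = X \<union> S \<union> Q"
    and dis: "X \<inter> S = {}" "X \<inter> Q = {}" "S \<inter> Q = {}"
    and no: "\<And>x. x \<in> Q \<Longrightarrow> f x \<notin> X"
  shows "card X + card {x \<in> S. f x \<in> S} + card {x \<in> S. f x \<in> Q} =
         card S + card {x \<in> X. f x \<in> X}"
proof -
  have img: "f ` V = V" using bij by (simp add: bij_betw_def)
  have "card S = card {x \<in> S. f x \<in> X} + card {x \<in> S. f x \<in> S} + card {x \<in> S. f x \<in> Q}"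
    by (rule card_split3) (use fin dis img V in auto)
  moreover have "card X = card {x \<in> X. f x \<in> X} + card {x \<in> S. f x \<in> X} + card {x \<in> Q. f x \<in> X}"
    by (rule card_vimage_split3[OF fin bij V dis]) (use V in blast)
  moreover have "{x \<in> Q. f x \<in> X} = {}" using no by blast
  ultimately show ?thesis by simp
qed

lemma walk_exit:
  assumes "w 0 \<in> W" "w m \<notin> W"
  shows "\<exists>k<m. w k \<in> W \<and> w (Suc k) \<notin> W"
  using assms
proof (induction m)
  case (Suc m)
  then show ?case by (cases "w m \<in> W") (auto intro: less_SucI)
qed simp

text \<open>Once arcs inside \<open>X\<close>, inside \<open>S\<close> and out of
  \<open>X \<union> S\<close> are excluded, each step swaps \<open>X\<close> and \<open>S\<close>. A
  closed walk of odd length is then impossible.\<close>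

lemma walk_alternates:
  assumes "w 0 \<in> X \<union> S" "X \<inter> S = {}"
    and "\<And>k. k < m \<Longrightarrow> \<not> (w k \<in> X \<and> w (Suc k) \<in> X)"
    and "\<And>k. k < m \<Longrightarrow> \<not> (w k \<in> S \<and> w (Suc k) \<in> S)"
    and "\<And>k. k < m \<Longrightarrow> \<not> (w k \<in> X \<union> S \<and> w (Suc k) \<notin> X \<union> S)"
    and "k \<le> m"
  shows "w k \<in> X \<union> S \<and> (w k \<in> X \<longleftrightarrow> (w 0 \<in> X \<longleftrightarrow> even k))"
  using assms(6)
proof (induction k)
  case (Suc k)
  then have "w k \<in> X \<union> S" "w k \<in> X \<longleftrightarrow> (w 0 \<in> X \<longleftrightarrow> even k)" by auto
  then show ?case using assms(2) assms(3-5)[of k] Suc.prems by auto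
qed (use assms in simp)

section \<open>The expansion bound for \<open>n = 2\<close>\<close>

text \<open>The vertices \<open>v\<close>, \<open>v + 1\<close>, \<open>v - 1\<close>,
  \<open>v + d\<close>, \<open>v - d\<close> are distinct modulo \<open>d\<^sup>2\<close>, because
  their differences are at most \<open>2 * d < d\<^sup>2\<close>.\<close>

lemma card_closed_nbhd_singleton_2:
  fixes d :: int
  assumes "d \<ge> 3" "v \<in> {0..<d\<^sup>2}" "v \<in> X"
  shows "5 \<le> card (closed_nbhd d 2 X)"
proof -
  let ?C = "{0, 1, -1, d, -d}"
  let ?f = "\<lambda>c. (v + c) mod d\<^sup>2"
  have N: "d\<^sup>2 > 2 * d" using assms(1) by (simp add: power2_eq_square)
  have "inj_on ?f ?C"
  proof (rule inj_onI)
    fix a b assume ab: "a \<in> ?C" "b \<in> ?C" "?f a = ?f b"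
    have "\<bar>a\<bar> \<le> d" "\<bar>b\<bar> \<le> d" using ab(1,2) assms(1) by auto
    then have "\<bar>(v + a) - (v + b)\<bar> < d\<^sup>2" using N by linarith
    from mod_eq_imp_eq[OF ab(3) this] show "a = b" by simp
  qed
  then have "card (?f ` ?C) = card ?C" by (rule card_image)
  also have "card ?C = 5" using assms(1) by simp
  finally have "card (?f ` ?C) = 5" .
  moreover have "?f ` ?C \<subseteq> closed_nbhd d 2 X"
  proof
    fix y assume "y \<in> ?f ` ?C"
    then obtain c where c: "c \<in> ?C" "y = ?f c" by blast
    have "0 \<le> y" "y < d\<^sup>2" using c(2) N assms(1) by auto
    moreover have "y \<in> X \<or> (\<exists>i<2. shift d 2 i y \<in> X \<or> y \<in> shift d 2 i ` X)"
    proof -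
      have v: "v mod d\<^sup>2 = v" using assms(2) by simp
      consider "c = 0" | "c = 1" | "c = -1" | "c = d" | "c = -d" using c(1) by blast
      then show ?thesis
      proof cases
        case 1 then show ?thesis using c assms(3) v by simp
      next
        case 2 then have "y = shift d 2 0 v" using c by (simp add: shift_def)
        then show ?thesis using assms(3) by (auto intro!: exI[of _ 0])
      next
        case 3 then have "shift d 2 0 y = v" using c v by (simp add: shift_def mod_simps)
        then show ?thesis using assms(3) by (auto intro!: exI[of _ 0])
      next
        case 4 then have "y = shift d 2 1 v" using c by (simp add: shift_def)
        then show ?thesis using assms(3) by (auto intro!: exI[of _ 1])
      next
        case 5 then have "shift d 2 1 y = v" using c v by (simp add: shift_def mod_simps)
        then show ?thesis using assms(3) by (auto intro!: exI[of _ 1])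
      qed
    qed
    ultimately show "y \<in> closed_nbhd d 2 X" unfolding closed_nbhd_def by simp
  qed
  ultimately show ?thesis by (metis card_mono finite_closed_nbhd)
qed

lemma card_residue_class:
  fixes d j :: int
  assumes "d > 0" "j \<in> {0..<d}"
  shows "card {x \<in> {0..<d\<^sup>2}. x mod d = j} = nat d"
proof -
  have "{x \<in> {0..<d\<^sup>2}. x mod d = j} = (\<lambda>k. j + d * k) ` {0..<d}"
  proof (intro equalityI subsetI)
    fix x assume x: "x \<in> {x \<in> {0..<d\<^sup>2}. x mod d = j}"
    have xj: "x = j + d * (x div d)" using x by auto
    have "d * (x div d) < d * d"
      using x pos_mod_sign[OF assms(1), of x] mult_div_mod_eq[of d x]
      unfolding power2_eq_square mem_Collect_eq atLeastLessThan_iff by linarith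
    then have "x div d < d" using assms(1) by (simp only: mult_less_cancel_left_pos)
    then have "x div d \<in> {0..<d}" using x assms(1) by (simp add: pos_imp_zdiv_nonneg_iff)
    with xj show "x \<in> (\<lambda>k. j + d * k) ` {0..<d}" by blast
  next
    fix x assume "x \<in> (\<lambda>k. j + d * k) ` {0..<d}"
    then obtain k where k: "0 \<le> k" "k \<le> d - 1" "x = j + d * k" by auto
    have "d * k \<le> d * (d - 1)" using k assms(1) by (intro mult_left_mono) auto
    then have "x < d\<^sup>2" using k(3) assms(2) by (simp add: power2_eq_square algebra_simps)
    then show "x \<in> {x \<in> {0..<d\<^sup>2}. x mod d = j}" using k assms by simp
  qed
  moreover have "inj_on (\<lambda>k. j + d * k) {0..<d}" using assms(1) by (auto simp: inj_on_def)
  ultimately show ?thesis by (simp add: card_image)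
qed

lemma mod_sq_mod: "((a::int) mod d\<^sup>2) mod d = a mod d"
  by (simp add: power2_eq_square mod_mod_cancel)

text \<open>Reducing modulo \<open>d\<close> forces \<open>k = l\<close>, since both are below
  \<open>d\<close>. So walks of fewer than \<open>d\<close> unit steps from distinct vertices of one
  residue class never meet; this makes the exits and the odd cycles below distinct.\<close>

lemma translate_inj_on_class:
  fixes d :: int
  assumes "x mod d = y mod d" "x \<in> {0..<d\<^sup>2}" "y \<in> {0..<d\<^sup>2}" "k < nat d" "l < nat d"
    "(x + int k) mod d\<^sup>2 = (y + int l) mod d\<^sup>2"
  shows "x = y"
proof -
  have "(x + int k) mod d = (y + int l) mod d" using assms(6) by (metis mod_sq_mod)
  then have "(x + int k - x) mod d = (y + int l - y) mod d" using assms(1) by (metis mod_diff_cong)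
  then have kl: "int k = int l" using assms(4,5) by simp
  have "(x + int k - int k) mod d\<^sup>2 = (y + int l - int l) mod d\<^sup>2"
    using assms(6) kl by (metis mod_diff_left_eq)
  then show ?thesis using assms(2,3) by simp
qed

text \<open>Were the bound to fail, the set \<open>Q\<close> of vertices outside the closed
  neighbourhood \<open>W\<close> would have at most \<open>t\<close> arcs of each of the two types entering it. If \<open>Q\<close> contains
  a residue class modulo \<open>d\<close>, this forces \<open>card W \<le> t\<^sup>2 < 5\<close>. Otherwise there are \<open>d\<close> edge-disjoint
  odd cycles, each of which has an arc inside \<open>X\<close>, inside \<open>W - X\<close> or from \<open>W\<close> to \<open>Q\<close>; but there
  are at most \<open>2 * t\<close> such arcs.\<close>

lemma expansion_two:
  fixes d :: int
  assumes d: "d \<ge> 3" and X: "X \<subseteq> {0..<d\<^sup>2}" "X \<noteq> {}" and t: "2 * int t + 1 \<le> d" "t \<le> 2"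
  shows "2 * card X + t < card (closed_nbhd d 2 X) + inner_arcs d 2 X"
proof (rule ccontr)
  assume neg: "\<not> ?thesis"
  define V where "V = {0..<d\<^sup>2}"
  define W where "W = closed_nbhd d 2 X"
  define S where "S = W - X"
  define Q where "Q = V - W"
  define s where "s = shift d 2"
  have s0: "s 0 x = (x + 1) mod d\<^sup>2" and s1: "s 1 x = (x + d) mod d\<^sup>2" for x
    by (simp_all add: s_def shift_def)
  have finV: "finite V" by (simp add: V_def)
  have XW: "X \<subseteq> W" and WV: "W \<subseteq> V" unfolding W_def V_def closed_nbhd_def using X by auto
  have finX: "finite X" and finW: "finite W" and finS: "finite S" and finQ: "finite Q"
    using finV XW WV unfolding S_def Q_def by (auto intro: finite_subset)
  have VXSQ: "V = X \<union> S \<union> Q" and dis: "X \<inter> S = {}" "X \<inter> Q = {}" "S \<inter> Q = {}"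
    and WXS: "W = X \<union> S" using XW WV unfolding S_def Q_def by auto
  have sV: "s i x \<in> V" for i x unfolding s_def V_def by (rule shift_in) (use d in simp)
  have bij: "bij_betw (s i) V V" for i unfolding s_def V_def by (rule bij_betw_shift) (use d in simp)
  have noQX: "s i x \<notin> X" if "x \<in> Q" "i < 2" for i x
    using that unfolding Q_def W_def closed_nbhd_def V_def s_def by auto
  have noXQ: "s i x \<notin> Q" if "x \<in> X" "i < 2" for i x
    using that sV[of i x] unfolding Q_def W_def closed_nbhd_def V_def s_def by auto
  define xx where "xx i = card {x \<in> X. s i x \<in> X}" for i
  define ss where "ss i = card {x \<in> S. s i x \<in> S}" for i
  define sq where "sq i = card {x \<in> S. s i x \<in> Q}" for i
  have bal: "card X + ss i + sq i = card S + xx i" if "i < 2" for i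
    unfolding xx_def ss_def sq_def
    by (rule perm_balance[OF finV bij VXSQ dis]) (use noQX that in blast)
  have inner: "inner_arcs d 2 X = xx 0 + xx 1"
    unfolding inner_arcs_def xx_def s_def by (simp add: numeral_2_eq_2)
  have cW: "card W = card X + card S"
    unfolding WXS by (rule card_Un_disjoint) (use finX finS dis in auto)
  have small: "card S + xx 0 + xx 1 \<le> card X + t"
    using neg cW inner unfolding W_def by simp
  \<comment> \<open>Eliminating \<open>card S - card X\<close> from \<open>small\<close> by the
    balance of type 0 leaves \<open>ss 0 + sq 0 + xx 1 \<le> t\<close>; type 1 gives
    \<open>ss 1 + sq 1 + xx 0 \<le> t\<close>.\<close>
  have sq0: "sq 0 \<le> t" and sq1: "sq 1 \<le> t"
    and tot: "xx 0 + ss 0 + sq 0 + (xx 1 + ss 1 + sq 1) \<le> 2 * t"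
    using bal[of 0] bal[of 1] small by auto
  have exit: "{x \<in> W. s i x \<in> Q} = {x \<in> S. s i x \<in> Q}" if "i < 2" for i
    using noXQ that WXS by blast
  define row where "row x = x mod d" for x
  have row0: "row ((a + b) mod d\<^sup>2) = (a + b) mod d" for a b
    unfolding row_def by (rule mod_sq_mod)
  have row_range: "row x \<in> {0..<d}" for x unfolding row_def using d by simp
  have rowexit: "\<exists>y\<in>W. s 1 y \<in> Q \<and> row y = row x" if x: "x \<in> W" "z \<in> Q" "row z = row x" for x z
  proof -
    define w where "w k = (x + int k * d) mod d\<^sup>2" for k
    have xz: "x \<in> V" "z \<in> V" using x WV unfolding Q_def by auto
    define m where "m = nat ((z - x) div d mod d)"
    have "z mod d = x mod d" using x(3) by (simp add: row_def)
    then have "d dvd z - x" by (simp add: mod_eq_dvd_iff)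
    then have zx: "d * ((z - x) div d) = z - x" by simp
    have "int m * d mod d\<^sup>2 = (z - x) mod d\<^sup>2"
    proof -
      have "int m * d = d * ((z - x) div d mod d)" using d by (simp add: m_def)
      also have "\<dots> = (d * ((z - x) div d)) mod d\<^sup>2"
        by (simp only: power2_eq_square mult_mod_right)
      finally show ?thesis by (simp only: zx mod_mod_trivial)
    qed
    then have "w m = (x + (z - x)) mod d\<^sup>2"
      unfolding w_def by (intro mod_add_cong) simp_all
    then have wm: "w m = z" using xz unfolding V_def by simp
    have w0: "w 0 = x" using xz unfolding w_def V_def by simp
    obtain k where k: "w k \<in> W" "w (Suc k) \<notin> W"
      using walk_exit[of w W m] wm w0 x unfolding Q_def by auto
    have "w (Suc k) = s 1 (w k)" unfolding w_def s1 by (simp add: mod_simps algebra_simps)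
    moreover have "row (w k) = row x" unfolding w_def row0 by (simp add: row_def)
    ultimately show ?thesis using k sV[of 1 "w k"] unfolding Q_def by auto
  qed
  \<comment> \<open>A residue class is a single cycle of type 1 arcs. If it meets both
    \<open>W\<close> and \<open>Q\<close>, it contains an arc from \<open>W\<close> to
    \<open>Q\<close>, and arcs in different classes are different.\<close>
  have rows_meeting: "card R \<le> t"
    if R: "\<And>r. r \<in> R \<Longrightarrow> \<exists>x\<in>W. \<exists>z\<in>Q. row x = r \<and> row z = r" for R
  proof -
    have "R \<subseteq> row ` {x \<in> W. s 1 x \<in> Q}"
    proof
      fix r assume "r \<in> R"
      then obtain x z where "x \<in> W" "z \<in> Q" "row x = r" "row z = r" using R by blast
      then obtain y where "y \<in> W" "s 1 y \<in> Q" "row y = r" using rowexit[of x z] by metis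
      then show "r \<in> row ` {x \<in> W. s 1 x \<in> Q}" by blast
    qed
    then have "card R \<le> card {x \<in> W. s 1 x \<in> Q}"
      by (rule surj_card_le[rotated]) (use finW in simp)
    then show ?thesis using sq1 exit[of 1] unfolding sq_def by simp
  qed
  show False
  proof (cases "\<exists>r\<in>{0..<d}. \<forall>x\<in>V. row x = r \<longrightarrow> x \<in> Q")
    case True
    then obtain r where r: "r \<in> {0..<d}" "\<And>x. x \<in> V \<Longrightarrow> row x = r \<Longrightarrow> x \<in> Q" by blast
    \<comment> \<open>The class \<open>r\<close> is a wall: unit steps from any vertex of
      \<open>W\<close> reach it in fewer than \<open>d\<close> steps, so they leave \<open>W\<close>
      before that.\<close>
    have ex: "\<exists>k<nat d. (x + int k) mod d\<^sup>2 \<in> {x \<in> W. s 0 x \<in> Q}" if x: "x \<in> W" for x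
    proof -
      define w where "w k = (x + int k) mod d\<^sup>2" for k
      define m where "m = nat ((r - x) mod d)"
      have wV: "w k \<in> V" for k unfolding w_def V_def using d by simp
      have im: "int m = (r - x) mod d" using d by (simp add: m_def)
      have "row (w m) = r" unfolding w_def row0 im using r(1) by (simp add: mod_simps)
      then have "w m \<notin> W" using r(2)[of "w m"] wV[of m] unfolding Q_def by blast
      moreover have "w 0 \<in> W" using x WV unfolding w_def V_def by auto
      ultimately obtain k where k: "k < m" "w k \<in> W" "w (Suc k) \<notin> W"
        using walk_exit[of w W m] by blast
      have "w (Suc k) = s 0 (w k)" unfolding w_def s0 by (simp add: mod_simps algebra_simps)
      moreover have "m < nat d" unfolding m_def using d by simp
      ultimately show ?thesis using k wV[of "Suc k"] unfolding w_def[symmetric] Q_def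
        by (intro exI[of _ k]) auto
    qed
    define h where "h x = (SOME k. k < nat d \<and> (x + int k) mod d\<^sup>2 \<in> {x \<in> W. s 0 x \<in> Q})" for x
    have h: "h x < nat d \<and> (x + int (h x)) mod d\<^sup>2 \<in> {x \<in> W. s 0 x \<in> Q}" if "x \<in> W" for x
      unfolding h_def by (rule someI_ex) (use ex[OF that] in blast)
    have rowle: "card {x \<in> W. row x = j} \<le> t" for j
    proof -
      have "card {x \<in> W. row x = j} \<le> card {x \<in> W. s 0 x \<in> Q}"
      proof (rule card_inj_on_le)
        show "inj_on (\<lambda>x. (x + int (h x)) mod d\<^sup>2) {x \<in> W. row x = j}"
        proof (rule inj_onI)
          fix x y assume xy: "x \<in> {x \<in> W. row x = j}" "y \<in> {x \<in> W. row x = j}"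
            "(x + int (h x)) mod d\<^sup>2 = (y + int (h y)) mod d\<^sup>2"
          show "x = y"
            by (rule translate_inj_on_class[of _ d _ "h x" "h y"])
              (use xy h[of x] h[of y] WV in \<open>auto simp: row_def V_def\<close>)
        qed
        show "(\<lambda>x. (x + int (h x)) mod d\<^sup>2) ` {x \<in> W. row x = j} \<subseteq> {x \<in> W. s 0 x \<in> Q}"
          using h by blast
        show "finite {x \<in> W. s 0 x \<in> Q}" using finW by simp
      qed
      then show ?thesis using sq0 exit[of 0] unfolding sq_def by simp
    qed
    have "card (row ` W) \<le> t"
    proof (rule rows_meeting)
      fix j assume "j \<in> row ` W"
      then obtain x where x: "x \<in> W" "row x = j" by blast
      have "\<exists>z\<in>V. row z = j \<and> z \<notin> W"
      proof (rule ccontr)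
        assume "\<not> ?thesis"
        then have "{x \<in> {0..<d\<^sup>2}. x mod d = j} \<subseteq> {x \<in> W. row x = j}"
          unfolding row_def V_def by blast
        then have "card {x \<in> {0..<d\<^sup>2}. x mod d = j} \<le> card {x \<in> W. row x = j}"
          by (rule card_mono[rotated]) (use finW in simp)
        then show False
          using card_residue_class[of d j] row_range[of x] x(2) rowle[of j] d t(1) by simp
      qed
      then show "\<exists>x\<in>W. \<exists>z\<in>Q. row x = j \<and> row z = j" using x unfolding Q_def by blast
    qed
    have "card W = (\<Sum>j\<in>row ` W. card {x \<in> W. row x = j})"
    proof -
      have "W = (\<Union>j\<in>row ` W. {x \<in> W. row x = j})" by blast
      also have "card \<dots> = (\<Sum>j\<in>row ` W. card {x \<in> W. row x = j})"
        by (rule card_UN_disjoint) (use finW in auto)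
      finally show ?thesis .
    qed
    also have "\<dots> \<le> card (row ` W) * t"
      using sum_bounded_above[of "row ` W" "\<lambda>j. card {x \<in> W. row x = j}" t] rowle by simp
    also have "\<dots> \<le> 2 * 2" using \<open>card (row ` W) \<le> t\<close> t(2) by (intro mult_le_mono) auto
    finally have "card W \<le> 4" by simp
    moreover obtain v where "v \<in> X" using X(2) by blast
    ultimately show False
      using card_closed_nbhd_singleton_2[of d v X] d X(1) unfolding W_def by auto
  next
    case False
    then have meet: "\<exists>x\<in>W. row x = r" if "r \<in> {0..<d}" for r
      using that unfolding Q_def by auto
    \<comment> \<open>The tails of the arcs that break the alternation between \<open>X\<close> and
      \<open>S\<close> or lead out of \<open>W\<close>. Every odd cycle that meets \<open>W\<close>
      has such an arc.\<close>
    define B where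
      "B i = ({x \<in> X. s i x \<in> X} \<union> {x \<in> S. s i x \<in> S}) \<union> {x \<in> W. s i x \<in> Q}" for i
    have finB: "finite (B i)" for i unfolding B_def using finX finS finW by simp
    have cB: "card (B i) \<le> xx i + ss i + sq i" if "i < 2" for i
    proof -
      have "card (B i) \<le> card ({x \<in> X. s i x \<in> X} \<union> {x \<in> S. s i x \<in> S}) + card {x \<in> W. s i x \<in> Q}"
        unfolding B_def by (rule card_Un_le)
      also have "card ({x \<in> X. s i x \<in> X} \<union> {x \<in> S. s i x \<in> S}) \<le> xx i + ss i"
        unfolding xx_def ss_def by (rule card_Un_le)
      finally show ?thesis using exit[OF that] unfolding sq_def by simp
    qed
    have alternates: "w k \<in> W \<and> (w k \<in> X \<longleftrightarrow> (w 0 \<in> X \<longleftrightarrow> even k))"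
      if w: "w 0 \<in> W" "\<And>k. w (Suc k) = s i (w k)" "\<And>k. k < m \<Longrightarrow> w k \<notin> B i" "k \<le> m" for w i m k
    proof -
      have B: "\<not> (w k \<in> X \<and> w (Suc k) \<in> X)" "\<not> (w k \<in> S \<and> w (Suc k) \<in> S)"
        "\<not> (w k \<in> X \<union> S \<and> w (Suc k) \<notin> X \<union> S)" if "k < m" for k
        using w(3)[OF that] sV[of i "w k"] unfolding B_def w(2) WXS VXSQ by blast+
      have "w k \<in> X \<union> S \<and> (w k \<in> X \<longleftrightarrow> (w 0 \<in> X \<longleftrightarrow> even k))"
        by (rule walk_alternates[OF w(1)[unfolded WXS] dis(1) B w(4)])
      then show ?thesis using WXS by blast
    qed
    have "nat d \<le> card (B 0) + card (B 1)"
    proof (cases "odd d")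
      case True
      \<comment> \<open>For odd \<open>d\<close> the residue classes themselves are the
        \<open>d\<close> odd cycles, made of arcs of type 1.\<close>
      have "{0..<d} \<subseteq> row ` B 1"
      proof (rule subsetI, rule ccontr)
        fix r assume r: "r \<in> {0..<d}" "r \<notin> row ` B 1"
        obtain x where x: "x \<in> W" "row x = r" using meet r(1) by blast
        define w where "w k = (x + int k * d) mod d\<^sup>2" for k
        have w0: "w 0 = x" using x WV unfolding w_def V_def by auto
        have "w (nat d) = x" using d w0 unfolding w_def by (simp add: power2_eq_square)
        moreover have "w (nat d) \<in> X \<longleftrightarrow> (w 0 \<in> X \<longleftrightarrow> even (nat d))"
        proof (rule alternates[THEN conjunct2, of w 1 "nat d" "nat d"])
          show "w (Suc k) = s 1 (w k)" for k
            unfolding w_def s1 by (simp add: mod_simps algebra_simps)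
          show "w k \<notin> B 1" for k
          proof
            assume "w k \<in> B 1"
            moreover have "row (w k) = r" using x(2) unfolding w_def row0 by (simp add: row_def)
            ultimately show False using r(2) by blast
          qed
        qed (use w0 x in auto)
        ultimately show False using w0 True d by (simp add: even_nat_iff)
      qed
      then have "card {0..<d} \<le> card (B 1)" using surj_card_le[OF finB[of 1]] by blast
      then show ?thesis by simp
    next
      case ev: False
      \<comment> \<open>For even \<open>d\<close> the odd cycles will pass through the vertices of
        one class, which must lie wholly in \<open>W\<close>. If there were none, all
        \<open>d\<close> classes would meet both \<open>W\<close> and \<open>Q\<close>, giving
        \<open>d > t\<close> exits.\<close>
      have "\<exists>j\<in>{0..<d}. \<forall>x\<in>V. row x = j \<longrightarrow> x \<in> W"
      proof (rule ccontr)
        assume none: "\<not> ?thesis"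
        have "card {0..<d} \<le> t"
        proof (rule rows_meeting)
          fix r assume r: "r \<in> {0..<d}"
          obtain z where "z \<in> V" "row z = r" "z \<notin> W" using none r by blast
          then show "\<exists>x\<in>W. \<exists>z\<in>Q. row x = r \<and> row z = r" using meet[OF r] unfolding Q_def by blast
        qed
        then show False using t d by simp
      qed
      then obtain j where j: "j \<in> {0..<d}" "\<And>x. x \<in> V \<Longrightarrow> row x = j \<Longrightarrow> x \<in> W" by blast
      define A where "A = {x \<in> {0..<d\<^sup>2}. x mod d = j}"
      \<comment> \<open>The odd cycle through \<open>a\<close> consists of the \<open>d\<close> unit
        steps from \<open>a\<close> to \<open>a + d\<close> and the type 1 arc joining these two
        ends. If the unit steps alternate, both ends lie on the same side because \<open>d\<close>
        is even, so the closing arc is the bad one.\<close>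
      have ex: "a \<in> B 1 \<or> (\<exists>k<nat d. (a + int k) mod d\<^sup>2 \<in> B 0)" if a: "a \<in> A" for a
      proof (rule ccontr)
        assume no: "\<not> ?thesis"
        define w where "w k = (a + int k) mod d\<^sup>2" for k
        have w0: "w 0 = a" using a unfolding w_def A_def by simp
        have aW: "a \<in> W" using a j(2) unfolding A_def V_def row_def by blast
        have "w (nat d) \<in> W \<and> (w (nat d) \<in> X \<longleftrightarrow> (w 0 \<in> X \<longleftrightarrow> even (nat d)))"
        proof (rule alternates[of w 0 "nat d"])
          show "w (Suc k) = s 0 (w k)" for k
            unfolding w_def s0 by (simp add: mod_simps algebra_simps)
          show "w k \<notin> B 0" if "k < nat d" for k using no that unfolding w_def by blast
        qed (use w0 aW in auto)
        moreover have "w (nat d) = s 1 a" using d unfolding w_def s1 by simp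
        ultimately have "s 1 a \<in> W" "s 1 a \<in> X \<longleftrightarrow> a \<in> X" using ev d w0 by (auto simp: even_nat_iff)
        then have "a \<in> B 1" using aW WXS dis unfolding B_def by blast
        then show False using no by blast
      qed
      define h where "h a = (SOME k. k < nat d \<and> (a + int k) mod d\<^sup>2 \<in> B 0)" for a
      have h: "h a < nat d \<and> (a + int (h a)) mod d\<^sup>2 \<in> B 0" if "a \<in> A - B 1" for a
        unfolding h_def by (rule someI_ex) (use ex that in blast)
      have "card (A - B 1) \<le> card (B 0)"
      proof (rule card_inj_on_le)
        show "inj_on (\<lambda>x. (x + int (h x)) mod d\<^sup>2) (A - B 1)"
        proof (rule inj_onI)
          fix x y assume xy: "x \<in> A - B 1" "y \<in> A - B 1"
            "(x + int (h x)) mod d\<^sup>2 = (y + int (h y)) mod d\<^sup>2"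
          show "x = y"
            by (rule translate_inj_on_class[of _ d _ "h x" "h y"])
              (use xy h[of x] h[of y] in \<open>auto simp: A_def\<close>)
        qed
      qed (use h finB in auto)
      moreover have "card A - card (B 1) \<le> card (A - B 1)" by (rule diff_card_le_card_Diff[OF finB])
      moreover have "card A = nat d" unfolding A_def using card_residue_class d j(1) by simp
      ultimately show ?thesis by simp
    qed
    then show False using cB[of 0] cB[of 1] tot t(1) by simp
  qed
qed

section \<open>Layers and the induction step\<close>

text \<open>The layers are the residue classes modulo \<open>d\<close>, each a copy of the circulant on \<open>d ^ n\<close>
  vertices.\<close>

definition layer :: "int \<Rightarrow> nat \<Rightarrow> int \<Rightarrow> int set \<Rightarrow> int set" where
  "layer d n j X = {t \<in> {0..<d ^ n}. d * t + j \<in> X}"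

lemma finite_layer: "finite (layer d n j X)"
  by (rule finite_subset[of _ "{0..<d ^ n}"]) (auto simp: layer_def)

lemma layer_vertex_bounds:
  fixes d :: int
  assumes "j \<in> {0..<d}" "t \<in> {0..<d ^ n}"
  shows "d * t + j \<in> {0..<d ^ Suc n}"
proof -
  have "d * t \<le> d * (d ^ n - 1)" using assms by (intro mult_left_mono) auto
  then show ?thesis using assms by (auto simp: algebra_simps)
qed

text \<open>Multiplying the division of \<open>t + d ^ i\<close> by \<open>d ^ n\<close> with
  \<open>d\<close> gives the division by \<open>d ^ Suc n\<close>, and the offset
  \<open>j < d\<close> causes no further wrap-around.\<close>

lemma shift_layer:
  fixes d :: int
  assumes j: "j \<in> {0..<d}"
  shows "shift d (Suc n) (Suc i) (d * t + j) = d * shift d n i t + j"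
proof -
  define r where "r = (t + d ^ i) mod d ^ n"
  define q where "q = (t + d ^ i) div d ^ n"
  have d: "d > 0" using j by simp
  have "t + d ^ i = r + d ^ n * q" unfolding r_def q_def by simp
  then have "d * t + j + d ^ Suc i = d * r + j + d ^ Suc n * q"
    by (metis (no_types, lifting) add.assoc add.commute distrib_left mult.assoc power_Suc)
  then have "shift d (Suc n) (Suc i) (d * t + j) = (d * r + j) mod d ^ Suc n"
    unfolding shift_def by (simp only: mod_mult_self2)
  also have "\<dots> = d * r + j"
    using layer_vertex_bounds[OF j, of r n] d unfolding r_def by simp
  finally show ?thesis unfolding r_def shift_def .
qed

lemma div_in_range:
  fixes d :: int
  assumes "d > 0" "x \<in> {0..<d ^ Suc n}"
  shows "x div d \<in> {0..<d ^ n}"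
proof -
  have "d * (x div d) \<le> x" using assms(1) pos_mod_sign[of d x] mult_div_mod_eq[of d x] by linarith
  also have "x < d * d ^ n" using assms(2) by simp
  finally have "x div d < d ^ n" using assms(1) by (simp only: mult_less_cancel_left_pos)
  then show ?thesis using assms by (simp add: pos_imp_zdiv_nonneg_iff)
qed

lemma card_layers:
  fixes d :: int
  assumes d: "d > 0" and Y: "Y \<subseteq> {0..<d ^ Suc n}"
  shows "card Y = (\<Sum>j\<in>{0..<d}. card (layer d n j Y))"
proof -
  have "Y = (\<Union>j\<in>{0..<d}. (\<lambda>t. d * t + j) ` layer d n j Y)"
  proof (intro equalityI subsetI)
    fix x assume x: "x \<in> Y"
    have "x = d * (x div d) + x mod d" by simp
    moreover have "x div d \<in> layer d n (x mod d) Y"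
      using div_in_range[OF d, of x n] x Y unfolding layer_def by auto
    moreover have "x mod d \<in> {0..<d}" using d by simp
    ultimately show "x \<in> (\<Union>j\<in>{0..<d}. (\<lambda>t. d * t + j) ` layer d n j Y)" by blast
  qed (auto simp: layer_def)
  also have "card \<dots> = (\<Sum>j\<in>{0..<d}. card ((\<lambda>t. d * t + j) ` layer d n j Y))"
  proof (rule card_UN_disjoint)
    show "\<forall>i\<in>{0..<d}. \<forall>j\<in>{0..<d}. i \<noteq> j \<longrightarrow>
      (\<lambda>t. d * t + i) ` layer d n i Y \<inter> (\<lambda>t. d * t + j) ` layer d n j Y = {}"
    proof (intro ballI impI equals0I)
      fix i j x assume ij: "i \<in> {0..<d}" "j \<in> {0..<d}" "i \<noteq> j"
        and "x \<in> (\<lambda>t. d * t + i) ` layer d n i Y \<inter> (\<lambda>t. d * t + j) ` layer d n j Y"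
      then obtain t u where "x = d * t + i" "x = d * u + j" by blast
      then have "(d * t + i) mod d = (d * u + j) mod d" by simp
      then show False using ij by simp
    qed
  qed (use finite_layer in auto)
  also have "\<dots> = (\<Sum>j\<in>{0..<d}. card (layer d n j Y))"
    using d by (intro sum.cong refl card_image) (auto simp: inj_on_def)
  finally show ?thesis .
qed

text \<open>Type \<open>Suc i\<close> restricts to type \<open>i\<close> in every layer. The
  inequality comes from dropping the arcs of type 0.\<close>

lemma inner_arcs_layers:
  fixes d :: int
  assumes d: "d > 0" and X: "X \<subseteq> {0..<d ^ Suc n}"
  shows "(\<Sum>j\<in>{0..<d}. inner_arcs d n (layer d n j X)) \<le> inner_arcs d (Suc n) X"
proof -
  have "(\<Sum>j\<in>{0..<d}. inner_arcs d n (layer d n j X)) =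
      (\<Sum>i<n. \<Sum>j\<in>{0..<d}. card {t \<in> layer d n j X. shift d n i t \<in> layer d n j X})"
    unfolding inner_arcs_def by (rule sum.swap)
  also have "\<dots> = (\<Sum>i<n. card {x \<in> X. shift d (Suc n) (Suc i) x \<in> X})"
  proof (rule sum.cong[OF refl])
    fix i
    let ?Y = "{x \<in> X. shift d (Suc n) (Suc i) x \<in> X}"
    have "layer d n j ?Y = {t \<in> layer d n j X. shift d n i t \<in> layer d n j X}"
      if "j \<in> {0..<d}" for j
      using shift_layer[OF that, of n i] shift_in[OF d, of n i] unfolding layer_def by auto
    then have "(\<Sum>j\<in>{0..<d}. card {t \<in> layer d n j X. shift d n i t \<in> layer d n j X}) =
        (\<Sum>j\<in>{0..<d}. card (layer d n j ?Y))"
      by (intro sum.cong) simp_all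
    also have "\<dots> = card ?Y" by (rule card_layers[OF d, symmetric]) (use X in blast)
    finally show "(\<Sum>j\<in>{0..<d}. card {t \<in> layer d n j X. shift d n i t \<in> layer d n j X}) = card ?Y" .
  qed
  also have "\<dots> \<le> inner_arcs d (Suc n) X"
    unfolding inner_arcs_def by (simp add: sum.lessThan_Suc_shift del: sum.lessThan_Suc)
  finally show ?thesis .
qed

lemma closed_nbhd_layer:
  fixes d :: int
  assumes j: "j \<in> {0..<d}"
  shows "closed_nbhd d n (layer d n j X) \<subseteq> layer d n j (closed_nbhd d (Suc n) X)"
proof
  fix t assume t: "t \<in> closed_nbhd d n (layer d n j X)"
  then have tr: "t \<in> {0..<d ^ n}" unfolding closed_nbhd_def by blast
  consider "t \<in> layer d n j X" | i where "i < n" "shift d n i t \<in> layer d n j X"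
    | i u where "i < n" "t = shift d n i u" "u \<in> layer d n j X"
    using t unfolding closed_nbhd_def by blast
  then have "d * t + j \<in> X \<or> (\<exists>i<Suc n. shift d (Suc n) i (d * t + j) \<in> X \<or>
      d * t + j \<in> shift d (Suc n) i ` X)"
  proof cases
    case 1
    then show ?thesis unfolding layer_def by simp
  next
    case (2 i)
    then have "shift d (Suc n) (Suc i) (d * t + j) \<in> X"
      unfolding shift_layer[OF j] layer_def by simp
    then show ?thesis using 2(1) by blast
  next
    case (3 i u)
    then have "d * t + j = shift d (Suc n) (Suc i) (d * u + j)" "d * u + j \<in> X"
      unfolding shift_layer[OF j] layer_def by simp_all
    then show ?thesis using 3(1) by blast
  qed
  then show "t \<in> layer d n j (closed_nbhd d (Suc n) X)"
    using layer_vertex_bounds[OF j tr] tr unfolding closed_nbhd_def[of d "Suc n"] layer_def by blast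
qed

text \<open>Used with \<open>c\<close> equal to 1 and -1: a layer next to layer \<open>j\<close>
  contains at least as many closed neighbours as layer \<open>j\<close> has elements of
  \<open>X\<close>, even if it is itself disjoint from \<open>X\<close>.\<close>

lemma card_layer_translate:
  fixes d c :: int
  assumes d: "d > 0" and j: "j \<in> {0..<d}"
    and img: "\<And>x. x \<in> X \<Longrightarrow> (x + c) mod d ^ Suc n \<in> Y" and "Y \<subseteq> {0..<d ^ Suc n}"
  shows "card (layer d n j X) \<le> card (layer d n ((j + c) mod d) Y)"
proof (rule card_inj_on_le[OF _ _ finite_layer])
  let ?y = "\<lambda>t. (d * t + j + c) mod d ^ Suc n"
  have modd: "?y t mod d = (j + c) mod d" for t
  proof -
    have "?y t mod d = (d * t + j + c) mod d" by (intro mod_mod_cancel) simp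
    also have "\<dots> = (j + c) mod d" by (simp add: add.assoc)
    finally show ?thesis .
  qed
  then have y: "d * (?y t div d) + (j + c) mod d = ?y t" for t
    by (metis mult_div_mod_eq)
  show "inj_on (\<lambda>t. ?y t div d) (layer d n j X)"
  proof (rule inj_onI)
    fix t u assume tu: "t \<in> layer d n j X" "u \<in> layer d n j X" "?y t div d = ?y u div d"
    then have "(d * t + j + c) mod d ^ Suc n = (d * u + j + c) mod d ^ Suc n" using y by metis
    then have "(d * t + j + c - c) mod d ^ Suc n = (d * u + j + c - c) mod d ^ Suc n"
      by (metis mod_diff_left_eq)
    moreover have "d * t + j \<in> {0..<d ^ Suc n}" "d * u + j \<in> {0..<d ^ Suc n}"
      using tu layer_vertex_bounds[OF j] unfolding layer_def by blast+
    ultimately show "t = u" using d by simp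
  qed
  show "(\<lambda>t. ?y t div d) ` layer d n j X \<subseteq> layer d n ((j + c) mod d) Y"
  proof (intro image_subsetI)
    fix t assume "t \<in> layer d n j X"
    then have "?y t \<in> Y" using img[of "d * t + j"] unfolding layer_def by blast
    then show "?y t div d \<in> layer d n ((j + c) mod d) Y"
      using div_in_range[OF d, of "?y t" n] assms(4) y[of t] unfolding layer_def by auto
  qed
qed

text \<open>The three conditions on \<open>c\<close> match the number of layers that
  \<open>X\<close> meets: \<open>c \<le> 3 * b\<close> for three or more,
  \<open>c \<le> 2 * b + 1\<close> for two, and \<open>single\<close>, which lacks the term
  \<open>2 * card Y\<close>, for one.\<close>

lemma expansion_step:
  fixes d :: int
  assumes d: "d \<ge> 3" and X: "X \<subseteq> {0..<d ^ Suc n}" "X \<noteq> {}"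
    and b: "\<And>Y. Y \<subseteq> {0..<d ^ n} \<Longrightarrow> Y \<noteq> {} \<Longrightarrow>
      2 * card Y + b \<le> card (closed_nbhd d n Y) + inner_arcs d n Y"
    and single: "\<And>Y. Y \<subseteq> {0..<d ^ n} \<Longrightarrow> Y \<noteq> {} \<Longrightarrow>
      c \<le> card (closed_nbhd d n Y) + inner_arcs d n Y"
    and c: "c \<le> 3 * b" "c \<le> 2 * b + 1"
  shows "2 * card X + c \<le> card (closed_nbhd d (Suc n) X) + inner_arcs d (Suc n) X"
proof -
  have d0: "d > 0" using d by simp
  define L where "L j = layer d n j X" for j
  define NL where "NL j = layer d n j (closed_nbhd d (Suc n) X)" for j
  \<comment> \<open>The share of layer \<open>j\<close> in the quantity to be bounded. It is at
    least \<open>b\<close> on layers meeting \<open>X\<close> and equals \<open>card (NL j)\<close>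
    on the others, so any selection of layers gives a lower bound.\<close>
  define h where "h j = int (card (NL j)) + int (inner_arcs d n (L j)) - 2 * int (card (L j))" for j
  have nb_sub: "closed_nbhd d (Suc n) X \<subseteq> {0..<d ^ Suc n}" unfolding closed_nbhd_def by blast
  have "(\<Sum>j\<in>{0..<d}. h j) = int (\<Sum>j\<in>{0..<d}. card (NL j)) +
      int (\<Sum>j\<in>{0..<d}. inner_arcs d n (L j)) - 2 * int (\<Sum>j\<in>{0..<d}. card (L j))"
    unfolding h_def by (simp add: sum.distrib sum_subtractf sum_distrib_left)
  then have sum_h: "(\<Sum>j\<in>{0..<d}. h j) \<le>
      int (card (closed_nbhd d (Suc n) X)) + int (inner_arcs d (Suc n) X) - 2 * int (card X)"
    using inner_arcs_layers[OF d0 X(1)] card_layers[OF d0 X(1)] card_layers[OF d0 nb_sub]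
    unfolding L_def NL_def by linarith
  have L_sub: "L j \<subseteq> {0..<d ^ n}" for j unfolding L_def layer_def by blast
  have NL_le: "card (closed_nbhd d n (L j)) \<le> card (NL j)" if "j \<in> {0..<d}" for j
    unfolding NL_def L_def by (rule card_mono[OF finite_layer closed_nbhd_layer[OF that]])
  have h_b: "int b \<le> h j" if "j \<in> {0..<d}" "L j \<noteq> {}" for j
    using b[OF L_sub that(2)] NL_le[OF that(1)] unfolding h_def by simp
  have h_single: "int c \<le> h j + 2 * int (card (L j))" if "j \<in> {0..<d}" "L j \<noteq> {}" for j
    using single[OF L_sub that(2)] NL_le[OF that(1)] unfolding h_def by simp
  have next_le: "card (L j) \<le> card (NL ((j + 1) mod d))" if "j \<in> {0..<d}" for j
    unfolding L_def NL_def
  proof (rule card_layer_translate[OF d0 that _ nb_sub])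
    fix x assume "x \<in> X"
    then have "shift d (Suc n) 0 x \<in> closed_nbhd d (Suc n) X"
      using shift_in[OF d0, of "Suc n" 0 x] unfolding closed_nbhd_def by blast
    then show "(x + 1) mod d ^ Suc n \<in> closed_nbhd d (Suc n) X" by (simp add: shift_def)
  qed
  have prev_le: "card (L j) \<le> card (NL ((j + - 1) mod d))" if "j \<in> {0..<d}" for j
    unfolding L_def NL_def
  proof (rule card_layer_translate[OF d0 that _ nb_sub])
    fix x assume x: "x \<in> X"
    define y where "y = (x + - 1) mod d ^ Suc n"
    have "shift d (Suc n) 0 y = x" using x X(1) by (auto simp: shift_def y_def mod_simps)
    moreover have "y \<in> {0..<d ^ Suc n}" unfolding y_def using d0 by simp
    ultimately have "y \<in> closed_nbhd d (Suc n) X" using x unfolding closed_nbhd_def by blast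
    then show "(x + - 1) mod d ^ Suc n \<in> closed_nbhd d (Suc n) X" unfolding y_def .
  qed
  have h_empty: "h j = int (card (NL j))" if "L j = {}" for j
    using that unfolding h_def inner_arcs_def by simp
  have h_nonneg: "0 \<le> h j" if "j \<in> {0..<d}" for j
    using h_b[OF that] h_empty[of j] by (cases "L j = {}") auto
  have sub_sum: "(\<Sum>j\<in>K. h j) \<le> (\<Sum>j\<in>{0..<d}. h j)" if "K \<subseteq> {0..<d}" for K
    by (rule sum_mono2) (use that h_nonneg in auto)
  define M where "M = {j \<in> {0..<d}. L j \<noteq> {}}"
  have M_sub: "M \<subseteq> {0..<d}" unfolding M_def by blast
  have finM: "finite M" by (rule finite_subset[OF M_sub]) simp
  have M_sum: "int (card M * b) \<le> (\<Sum>j\<in>M. h j)"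
    using sum_bounded_below[of M "int b" h] h_b unfolding M_def by simp
  have "M \<noteq> {}"
  proof
    assume "M = {}"
    then have "\<And>j. j \<in> {0..<d} \<Longrightarrow> card (layer d n j X) = 0" unfolding M_def L_def by auto
    then have "card X = 0" using card_layers[OF d0 X(1)] by simp
    then show False using X finite_subset[OF X(1)] by simp
  qed
  have "int c \<le> (\<Sum>j\<in>{0..<d}. h j)"
  proof -
    consider "card M \<ge> 3" | "card M = 2" | "card M = 1"
      using \<open>M \<noteq> {}\<close> card_gt_0_iff[of M] finM by linarith
    then show ?thesis
    proof cases
      case 1
      then have "3 * b \<le> card M * b" by (intro mult_right_mono) auto
      then show ?thesis using M_sum sub_sum[OF M_sub] c(1) by linarith
    next
      case 2
      \<comment> \<open>Two of at least three classes are not closed under adding 1; the empty layer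
        reached from \<open>j\<close> supplies the extra 1 in \<open>2 * b + 1\<close>.\<close>
      have "\<exists>j\<in>M. (j + 1) mod d \<notin> M"
      proof (rule ccontr)
        assume "\<not> ?thesis"
        then have closed: "(j + 1) mod d \<in> M" if "j \<in> M" for j using that by blast
        obtain a where a: "a \<in> M" using \<open>M \<noteq> {}\<close> by blast
        have walk: "(a + int k) mod d \<in> M" for k
        proof (induction k)
          case 0
          then show ?case using a M_sub by auto
        next
          case (Suc k)
          then show ?case using closed[of "(a + int k) mod d"] by (simp add: mod_simps algebra_simps)
        qed
        have "{0..<d} \<subseteq> M"
        proof
          fix x assume x: "x \<in> {0..<d}"
          have "int (nat ((x - a) mod d)) = (x - a) mod d" using d0 by simp
          then have "(a + int (nat ((x - a) mod d))) mod d = x" using x by (simp add: mod_simps)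
          then show "x \<in> M" using walk by metis
        qed
        then have "card {0..<d} \<le> card M" by (rule card_mono[OF finM])
        then show False using 2 d by simp
      qed
      then obtain j where j: "j \<in> M" "(j + 1) mod d \<notin> M" by blast
      define e where "e = (j + 1) mod d"
      have e: "e \<in> {0..<d}" "e \<notin> M" using j d0 unfolding e_def by auto
      have jr: "j \<in> {0..<d}" "L j \<noteq> {}" using j(1) unfolding M_def by auto
      have "L e = {}" using e unfolding M_def by blast
      moreover have "card (L j) > 0" using jr(2) finite_layer unfolding L_def by (simp add: card_gt_0_iff)
      ultimately have "1 \<le> h e" using h_empty[of e] next_le[OF jr(1)] unfolding e_def by simp
      moreover have "(\<Sum>j\<in>insert e M. h j) = h e + (\<Sum>j\<in>M. h j)" using finM e(2) by simp
      moreover have "(\<Sum>j\<in>insert e M. h j) \<le> (\<Sum>j\<in>{0..<d}. h j)" using sub_sum e(1) M_sub by simp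
      ultimately show ?thesis using M_sum 2 c(2) by simp
    next
      case 3
      then obtain a where M: "M = {a}" by (metis card_1_singletonE)
      have a: "a \<in> {0..<d}" "L a \<noteq> {}" using M unfolding M_def by auto
      define e f where "e = (a + 1) mod d" and "f = (a + - 1) mod d"
      have ef: "e \<in> {0..<d}" "f \<in> {0..<d}" unfolding e_def f_def using d0 by auto
      have am: "a = (a + 0) mod d" using a by simp
      have "e \<noteq> a"
        using mod_eq_imp_eq[of "a + 1" d "a + 0"] am d unfolding e_def by auto
      moreover have "f \<noteq> a"
        using mod_eq_imp_eq[of "a + - 1" d "a + 0"] am d unfolding f_def by auto
      moreover have "e \<noteq> f"
        using mod_eq_imp_eq[of "a + 1" d "a + - 1"] d unfolding e_def f_def by auto
      ultimately have ne: "e \<noteq> a" "f \<noteq> a" "e \<noteq> f" by auto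
      \<comment> \<open>The two adjacent layers, distinct because \<open>d \<ge> 3\<close>, each
        contribute \<open>card (L a)\<close> and together cancel the loss
        \<open>2 * card (L a)\<close> in layer \<open>a\<close>.\<close>
      have "L e = {}" "L f = {}" using ne M ef unfolding M_def by blast+
      then have "int (card (L a)) \<le> h e" "int (card (L a)) \<le> h f"
        using h_empty next_le[OF a(1)] prev_le[OF a(1)] unfolding e_def f_def by simp_all
      moreover have "h a + h e + h f \<le> (\<Sum>j\<in>{0..<d}. h j)"
        using sub_sum[of "{a, e, f}"] a ef ne by simp
      ultimately show ?thesis using h_single[OF a] by linarith
    qed
  qed
  then show ?thesis using sum_h by linarith
qed

lemma closed_nbhd_expansion:
  fixes d :: int
  assumes d: "d \<ge> 3" and n: "n \<ge> 2" and X: "X \<subseteq> {0..<d ^ n}" "X \<noteq> {}"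
  shows "2 * card X + (if n = 2 \<and> d < 5 then 2 else 2 * n - 1)
    \<le> card (closed_nbhd d n X) + inner_arcs d n X"
  using n X
proof (induction n arbitrary: X rule: dec_induct)
  case base
  show ?case
  proof (cases "d < 5")
    case True
    \<comment> \<open>The largest \<open>t \<le> 2\<close> with \<open>2 * t + 1 \<le> d\<close> is
      1 here and 2 for \<open>d \<ge> 5\<close>; the strict inequality turns it into 2 and
      3.\<close>
    then show ?thesis using expansion_two[OF d, of X 1] base d by simp
  next
    case False
    then show ?thesis using expansion_two[OF d, of X 2] base d by simp
  qed
next
  case (step n)
  define b :: nat where "b = (if n = 2 \<and> d < 5 then 2 else 2 * n - 1)"
  have b: "2 * card Y + b \<le> card (closed_nbhd d n Y) + inner_arcs d n Y"
    if "Y \<subseteq> {0..<d ^ n}" "Y \<noteq> {}" for Y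
    using step.IH[OF that] unfolding b_def .
  \<comment> \<open>From the weak start \<open>b = 2\<close> the target is 5, which is exactly
    \<open>2 * b + 1\<close>. The weak bound plus 2 falls one short of the 5 that
    \<open>single\<close> asks for, hence the five explicit closed neighbours.\<close>
  have "2 * card X + (2 * n + 1) \<le> card (closed_nbhd d (Suc n) X) + inner_arcs d (Suc n) X"
  proof (rule expansion_step[OF d step.prems b])
    show "2 * n + 1 \<le> card (closed_nbhd d n Y) + inner_arcs d n Y"
      if Y: "Y \<subseteq> {0..<d ^ n}" "Y \<noteq> {}" for Y
    proof (cases "n = 2 \<and> d < 5")
      case True
      then obtain v where v: "v \<in> Y" "v \<in> {0..<d\<^sup>2}" using Y by blast
      show ?thesis using card_closed_nbhd_singleton_2[OF d v(2,1)] True by simp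
    next
      case False
      have "card Y > 0" using Y finite_subset[OF Y(1)] by (simp add: card_gt_0_iff)
      then show ?thesis using b[OF Y] False step.hyps unfolding b_def by (simp split: if_splits)
    qed
  qed (use step.hyps in \<open>auto simp: b_def\<close>)
  then show ?case using step.hyps by simp
qed

section \<open>Deleting vertices and edges\<close>

lemma verts_recursive_circulant: "verts (recursive_circulant n d) = {0..<int d ^ n}"
  by (simp add: verts_def recursive_circulant_def)

lemma edges_recursive_circulant:
  assumes "d > 0"
  shows "edges (recursive_circulant n d) =
    {{x, shift (int d) n i x} | x i. x \<in> {0..<int d ^ n} \<and> i < n}"
proof (intro equalityI subsetI)
  fix e assume "e \<in> edges (recursive_circulant n d)"
  then obtain u v i where uv: "e = {u, v}" "u \<in> {0..<int d ^ n}" "v \<in> {0..<int d ^ n}" "i < n"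
    and c: "[u - v = int d ^ i] (mod (int d ^ n)) \<or> [u - v = - (int d ^ i)] (mod (int d ^ n))"
    unfolding edges_def recursive_circulant_def by auto
  from c have "u = shift (int d) n i v \<or> v = shift (int d) n i u"
  proof
    assume "[u - v = int d ^ i] (mod (int d ^ n))"
    then have "[u - v + v = int d ^ i + v] (mod (int d ^ n))" by (rule cong_add) simp
    then show ?thesis using uv(2) by (simp add: cong_def shift_def add.commute)
  next
    assume "[u - v = - (int d ^ i)] (mod (int d ^ n))"
    then have "[u - v + (v + int d ^ i) = - (int d ^ i) + (v + int d ^ i)] (mod (int d ^ n))"
      by (rule cong_add) simp
    then show ?thesis using uv(3) by (simp add: cong_def shift_def)
  qed
  then show "e \<in> {{x, shift (int d) n i x} | x i. x \<in> {0..<int d ^ n} \<and> i < n}"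
    using uv by (auto simp: insert_commute)
next
  fix e assume "e \<in> {{x, shift (int d) n i x} | x i. x \<in> {0..<int d ^ n} \<and> i < n}"
  then obtain x i where e: "e = {shift (int d) n i x, x}" "x \<in> {0..<int d ^ n}" "i < n" by blast
  have "[shift (int d) n i x - x = int d ^ i] (mod (int d ^ n))"
    unfolding shift_def cong_def by (simp add: mod_simps)
  moreover have "shift (int d) n i x \<in> {0..<int d ^ n}" using shift_in[of "int d"] assms by simp
  ultimately show "e \<in> edges (recursive_circulant n d)"
    using e unfolding edges_def recursive_circulant_def by auto
qed

lemma two_powers_less:
  fixes d :: int
  assumes "d \<ge> 3" "i < n" "j < n"
  shows "d ^ i + d ^ j < d ^ n"
proof -
  obtain m where m: "n = Suc m" using assms(2) by (cases n) auto
  have "d ^ i \<le> d ^ m" "d ^ j \<le> d ^ m" using assms m by (auto intro: power_increasing)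
  moreover have "d ^ n \<ge> 3 * d ^ m" using assms(1) m by simp
  moreover have "d ^ m > 0" using assms(1) by simp
  ultimately show ?thesis by linarith
qed

lemma shift_neq:
  fixes d :: int
  assumes "d \<ge> 3" "i < n" "x \<in> {0..<d ^ n}"
  shows "shift d n i x \<noteq> x"
proof
  assume "shift d n i x = x"
  then have "(x + d ^ i) mod d ^ n = x mod d ^ n" using assms(3) unfolding shift_def by simp
  moreover have "d ^ i > 0" using assms(1) by simp
  ultimately show False
    using mod_eq_imp_eq[of "x + d ^ i" "d ^ n" x] two_powers_less[OF assms(1,2,2)] by linarith
qed

text \<open>Two arcs with the same tail differ by a nonzero amount below \<open>d ^ n\<close>. Two
  opposite arcs would give \<open>d ^ i + d ^ j\<close> divisible by \<open>d ^ n\<close>, which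
  \<open>two_powers_less\<close> excludes; for \<open>d = 2\<close> and \<open>i = j = n - 1\<close>
  this sum is \<open>d ^ n\<close> itself.\<close>

lemma inj_on_arc_edge:
  fixes d :: int
  assumes d: "d \<ge> 3"
  shows "inj_on (\<lambda>(i, x). {x, shift d n i x}) ({..<n} \<times> {0..<d ^ n})"
proof (rule inj_onI)
  fix p q
  assume pq: "p \<in> {..<n} \<times> {0..<d ^ n}" "q \<in> {..<n} \<times> {0..<d ^ n}"
    "(\<lambda>(i, x). {x, shift d n i x}) p = (\<lambda>(i, x). {x, shift d n i x}) q"
  obtain i x j y where [simp]: "p = (i, x)" "q = (j, y)" by (metis surj_pair)
  have ij: "i \<in> {..<n}" "j \<in> {..<n}" and xy: "x \<in> {0..<d ^ n}" "y \<in> {0..<d ^ n}"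
    and eq: "{x, shift d n i x} = {y, shift d n j y}" using pq by simp_all
  have pos: "d ^ i > 0" "d ^ j > 0" using d by simp_all
  have lt: "d ^ i + d ^ j < d ^ n" using two_powers_less[OF d] ij by simp
  from eq consider "x = y" "shift d n i x = shift d n j x" | "x = shift d n j y" "y = shift d n i x"
    unfolding doubleton_eq_iff by metis
  then show "p = q"
  proof cases
    case 1
    then have "(x + d ^ i) mod d ^ n = (x + d ^ j) mod d ^ n" unfolding shift_def by simp
    then have "x + d ^ i = x + d ^ j" by (rule mod_eq_imp_eq) (use lt pos in simp)
    then show ?thesis using 1 d by simp
  next
    case 2
    then have "x = (x + d ^ i + d ^ j) mod d ^ n" unfolding shift_def by (metis mod_add_left_eq)
    then have "(x + d ^ i + d ^ j) mod d ^ n = x mod d ^ n" using xy by simp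
    from mod_eq_imp_eq[OF this] show ?thesis using lt pos by simp
  qed
qed

lemma recursive_circulant_edge:
  assumes "d \<ge> 3" "e \<in> edges (recursive_circulant n d)"
  shows "\<exists>u v. u \<in> {0..<int d ^ n} \<and> v \<in> {0..<int d ^ n} \<and> u \<noteq> v \<and> e = {u, v}"
proof -
  obtain x i where x: "e = {x, shift (int d) n i x}" "x \<in> {0..<int d ^ n}" "i < n"
    using assms edges_recursive_circulant[of d n] by auto
  have d: "int d \<ge> 3" "int d > 0" using assms(1) by simp_all
  have "shift (int d) n i x \<noteq> x" "shift (int d) n i x \<in> {0..<int d ^ n}"
    by (rule shift_neq[OF d(1) x(3,2)], rule shift_in[OF d(2)])
  then show ?thesis using x by metis
qed

lemma finite_edges_recursive_circulant:
  assumes "d \<ge> 3"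
  shows "finite (edges (recursive_circulant n d))"
proof (rule finite_subset)
  show "edges (recursive_circulant n d) \<subseteq> Pow {0..<int d ^ n}"
    using recursive_circulant_edge[OF assms] by blast
qed simp

lemma verts_delete_mixed: "verts (delete_mixed G F) = verts G - Inl -` F"
  by (simp add: delete_mixed_def delete_verts_def delete_edges_def verts_def)

lemma edges_delete_mixed:
  "edges (delete_mixed G F) = {e \<in> edges G - Inr -` F. e \<inter> Inl -` F = {}}"
  by (simp add: delete_mixed_def delete_verts_def delete_edges_def edges_def)

lemma verts_delete_edges: "verts (delete_edges G F) = verts G"
  by (simp add: delete_edges_def verts_def)

lemma edges_delete_edges: "edges (delete_edges G F) = edges G - F"
  by (simp add: delete_edges_def edges_def)

lemma delete_mixed_Inr: "delete_mixed G (Inr ` F) = delete_edges G F"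
proof -
  have eq: "Inr -` Inr ` F = F" "Inl -` Inr ` F = {}" by auto
  show ?thesis
    unfolding delete_mixed_def eq delete_verts_def delete_edges_def by (auto simp: verts_def edges_def)
qed

lemma closed_nbhd_edge:
  assumes "d > 0" "v \<in> closed_nbhd (int d) n X" "v \<notin> X" "X \<subseteq> {0..<int d ^ n}"
  shows "\<exists>u\<in>X. {u, v} \<in> edges (recursive_circulant n d)"
proof -
  have v: "v \<in> {0..<int d ^ n}" using assms(2) unfolding closed_nbhd_def by blast
  consider i where "i < n" "shift (int d) n i v \<in> X"
    | i x where "i < n" "x \<in> X" "v = shift (int d) n i x"
    using assms(2,3) unfolding closed_nbhd_def by blast
  then show ?thesis
  proof cases
    case (1 i)
    then have "{shift (int d) n i v, v} \<in> edges (recursive_circulant n d)"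
      unfolding edges_recursive_circulant[OF assms(1)] using v by blast
    then show ?thesis using 1 by blast
  next
    case (2 i x)
    then have "{x, v} \<in> edges (recursive_circulant n d)"
      unfolding edges_recursive_circulant[OF assms(1)] using assms(4) by blast
    then show ?thesis using 2 by blast
  qed
qed

text \<open>A neighbour of the barrier \<open>I\<close> outside \<open>I \<union> S\<close> is deleted or costs a deleted edge leaving \<open>I\<close>,
  and every edge inside \<open>I\<close> is deleted.\<close>

lemma preclusion_lower_bound:
  assumes d: "d \<ge> 3"
    and b: "\<And>X. X \<subseteq> {0..<int d ^ n} \<Longrightarrow> X \<noteq> {} \<Longrightarrow>
      2 * card X + b \<le> card (closed_nbhd (int d) n X) + inner_arcs (int d) n X"
    and F: "finite F" "F \<subseteq> verts (recursive_circulant n d) <+> edges (recursive_circulant n d)"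
    and no: "\<not> has_fractional_perfect_matching (delete_mixed (recursive_circulant n d) F)"
  shows "b < card F"
proof -
  define G where "G = recursive_circulant n d"
  define V where "V = {0..<int d ^ n}"
  define A where "A = Inl -` F"
  define B where "B = Inr -` F"
  define H where "H = delete_mixed G F"
  have d0: "d > 0" using d by simp
  have F_AB: "F = A <+> B"
  proof (rule set_eqI)
    show "z \<in> F \<longleftrightarrow> z \<in> A <+> B" for z by (cases z) (auto simp: A_def B_def)
  qed
  have finA: "finite A" and finB: "finite B"
    using F(1) unfolding A_def B_def by (auto intro: finite_vimageI)
  have vertsH: "verts H = V - A" unfolding H_def verts_delete_mixed G_def verts_recursive_circulant V_def A_def ..
  have edgesH: "edges H = {e \<in> edges G - B. e \<inter> A = {}}"
    unfolding H_def edges_delete_mixed A_def B_def ..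
  have wfG: "\<exists>u v. u \<in> V \<and> v \<in> V \<and> u \<noteq> v \<and> e = {u, v}" if "e \<in> edges G" for e
    using recursive_circulant_edge[OF d] that unfolding G_def V_def by blast
  have wfH: "\<exists>u v. u \<in> verts H \<and> v \<in> verts H \<and> u \<noteq> v \<and> e = {u, v}" if "e \<in> edges H" for e
  proof -
    have e: "e \<in> edges G" "e \<inter> A = {}" using that unfolding edgesH by auto
    obtain u v where "u \<in> V" "v \<in> V" "u \<noteq> v" "e = {u, v}" using wfG[OF e(1)] by blast
    then show ?thesis using e(2) unfolding vertsH by blast
  qed
  have finH: "finite (verts H)" unfolding vertsH V_def by simp
  have noH: "\<not> has_fractional_perfect_matching H" using no unfolding H_def G_def .
  obtain I S where IS: "I \<subseteq> verts H" "S \<subseteq> verts H" "I \<inter> S = {}" "card S < card I"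
    and bar: "\<And>u v. u \<in> I \<Longrightarrow> {u, v} \<in> edges H \<Longrightarrow> v \<in> S"
    using no_fractional_perfect_matching_barrier[OF finH wfH noH] by metis
  have finI: "finite I" and finS: "finite S"
    using IS(1,2) unfolding vertsH V_def by (auto intro: finite_subset[of _ "{0..<int d ^ n}"])
  have IV: "I \<subseteq> {0..<int d ^ n}" and IA: "I \<inter> A = {}" using IS(1) unfolding vertsH V_def by auto
  have inB: "{u, v} \<in> B" if "u \<in> I" "{u, v} \<in> edges G" "v \<notin> S" "v \<notin> A" for u v
    using bar[OF that(1), of v] that IA unfolding edgesH by blast
  define P where "P = (SIGMA i:{..<n}. {x \<in> I. shift (int d) n i x \<in> I})"
  \<comment> \<open>The neighbours still present that are not in the barrier: every edge joining one
    to \<open>I\<close> must have been deleted.\<close>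
  define L where "L = closed_nbhd (int d) n I - (I \<union> S \<union> A)"
  define c where "c = (\<lambda>(i, x). {x, shift (int d) n i x})"
  have "card P = inner_arcs (int d) n I"
    unfolding P_def inner_arcs_def using finI by (intro card_SigmaI) auto
  moreover have "inj_on c P"
    unfolding c_def by (rule inj_on_subset[OF inj_on_arc_edge]) (use d IV P_def in auto)
  ultimately have cP: "card (c ` P) = inner_arcs (int d) n I" by (simp add: card_image)
  have cPB: "c ` P \<subseteq> B"
  proof
    fix e assume "e \<in> c ` P"
    then obtain i x where e: "i < n" "x \<in> I" "shift (int d) n i x \<in> I" "e = {x, shift (int d) n i x}"
      unfolding c_def P_def by auto
    then have "e \<in> edges G" unfolding G_def edges_recursive_circulant[OF d0] using IV by blast
    then show "e \<in> B" using inB[of x "shift (int d) n i x"] e IS(3) IA by blast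
  qed
  have cPI: "e \<subseteq> I" if "e \<in> c ` P" for e using that unfolding c_def P_def by auto
  have "\<exists>u. u \<in> I \<and> {u, v} \<in> B" if vL: "v \<in> L" for v
  proof -
    have v: "v \<in> closed_nbhd (int d) n I" "v \<notin> I" "v \<notin> S" "v \<notin> A" using vL unfolding L_def by auto
    obtain u where "u \<in> I" "{u, v} \<in> edges G"
      using closed_nbhd_edge[OF d0 v(1,2) IV] unfolding G_def by blast
    then show ?thesis using inB[of u v] v by blast
  qed
  then obtain u where u: "\<And>v. v \<in> L \<Longrightarrow> u v \<in> I \<and> {u v, v} \<in> B" by metis
  have "inj_on (\<lambda>v. {u v, v}) L"
  proof (rule inj_onI)
    fix v w assume vw: "v \<in> L" "w \<in> L" "{u v, v} = {u w, w}"
    then have "v \<notin> I" "u w \<in> I" using u unfolding L_def by auto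
    then show "v = w" using vw(3) by (auto simp: doubleton_eq_iff)
  qed
  then have cL: "card ((\<lambda>v. {u v, v}) ` L) = card L" by (rule card_image)
  \<comment> \<open>The chosen edge at \<open>v\<close> has an endpoint outside \<open>I\<close>, so
    no deleted edge is charged both for a lost neighbour and for an inner arc.\<close>
  have "(\<lambda>v. {u v, v}) ` L \<inter> c ` P = {}" using cPI unfolding L_def by blast
  moreover have "finite (c ` P)" "finite ((\<lambda>v. {u v, v}) ` L)"
    using finite_subset[OF cPB finB] finite_closed_nbhd unfolding L_def by auto
  ultimately have "card L + inner_arcs (int d) n I = card ((\<lambda>v. {u v, v}) ` L \<union> c ` P)"
    using cL cP by (simp add: card_Un_disjoint)
  also have "\<dots> \<le> card B" by (rule card_mono[OF finB]) (use cPB u in auto)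
  finally have LB: "card L + inner_arcs (int d) n I \<le> card B" .
  have "card (closed_nbhd (int d) n I) \<le> card (((I \<union> S) \<union> A) \<union> L)"
    by (rule card_mono) (use finI finS finA finite_closed_nbhd L_def in auto)
  also have "\<dots> \<le> card I + card S + card A + card L"
    using card_Un_le[of "I \<union> S \<union> A" L] card_Un_le[of "I \<union> S" A] card_Un_le[of I S] by linarith
  finally have "card (closed_nbhd (int d) n I) \<le> card I + card S + card A + card L" .
  moreover have "I \<noteq> {}" using IS(4) by auto
  moreover have "card F = card A + card B" unfolding F_AB by (rule card_Plus[OF finA finB])
  ultimately show ?thesis using b[OF IV] IS(4) LB by linarith
qed

section \<open>Edge deletions for \<open>n = 2\<close> and even \<open>d\<close>\<close>

text \<open>Some unit step from \<open>x\<close> enters \<open>Q\<close>. Were it the only entering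
  arc, type 1 would permute \<open>Q\<close>; then \<open>x + d\<close> lies outside
  \<open>Q\<close> and \<open>x + 1 + d\<close> inside, so the unit step from \<open>x + d\<close>
  enters too.\<close>

lemma arcs_into_neq_one:
  fixes d :: int
  assumes d: "d \<ge> 3" and Q: "Q \<subseteq> {0..<d\<^sup>2}" "Q \<noteq> {}" "Q \<noteq> {0..<d\<^sup>2}"
  shows "2 \<le> (\<Sum>i<2. card {x \<in> {0..<d\<^sup>2} - Q. shift d 2 i x \<in> Q})"
proof (rule ccontr)
  define V where "V = {0..<d\<^sup>2}"
  define s where "s = shift d 2"
  define E where "E i = {x \<in> V - Q. s i x \<in> Q}" for i
  assume "\<not> ?thesis"
  then have few: "card (E 0) + card (E 1) \<le> 1"
    unfolding E_def V_def s_def by (simp add: numeral_2_eq_2)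
  have finE: "finite (E i)" for i
    by (rule finite_subset[of _ "{0..<d\<^sup>2}"]) (auto simp: E_def V_def)
  have s0: "s 0 x = (x + 1) mod d\<^sup>2" and s1: "s 1 x = (x + d) mod d\<^sup>2" for x
    by (simp_all add: s_def shift_def)
  have sV: "s i x \<in> V" for i x unfolding s_def V_def by (rule shift_in) (use d in simp)
  obtain a z where az: "a \<in> V" "a \<notin> Q" "z \<in> Q" using Q unfolding V_def by blast
  define w where "w k = (a + int k) mod d\<^sup>2" for k
  have wV: "w k \<in> V" for k unfolding w_def V_def using d by simp
  have w0: "w 0 \<in> V - Q" using az unfolding w_def V_def by simp
  have "int (nat ((z - a) mod d\<^sup>2)) = (z - a) mod d\<^sup>2" using d by simp
  then have "w (nat ((z - a) mod d\<^sup>2)) = (a + (z - a) mod d\<^sup>2) mod d\<^sup>2" unfolding w_def by simp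
  also have "\<dots> = z" using az(3) Q(1) by (auto simp: mod_simps)
  finally have "w (nat ((z - a) mod d\<^sup>2)) \<notin> V - Q" using az(3) by simp
  then obtain k where k: "w k \<in> V - Q" "w (Suc k) \<notin> V - Q"
    using walk_exit[of w "V - Q"] w0 by blast
  define x where "x = w k"
  have "s 0 x = w (Suc k)" unfolding x_def w_def s0 by (simp add: mod_simps algebra_simps)
  then have x: "x \<in> E 0" using k wV[of "Suc k"] unfolding E_def x_def by simp
  have "card (E 0) > 0" using x finE by (auto simp: card_gt_0_iff)
  then have "card (E 0) = 1" "card (E 1) = 0" using few by linarith+
  then have c: "card (E 0) = 1" "E 1 = {}" using finE by simp_all
  have "s 1 x \<in> V - Q" using c(2) x sV[of 1 x] unfolding E_def by blast
  moreover have "s 0 (s 1 x) \<in> Q"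
  proof (rule ccontr)
    assume out: "s 0 (s 1 x) \<notin> Q"
    have comm: "s 0 (s 1 x) = s 1 (s 0 x)" unfolding s0 s1 by (simp add: mod_simps algebra_simps)
    have fin: "finite V" and QV: "V = (V - Q) \<union> {} \<union> Q" and bij: "bij_betw (s 1) V V"
      using Q(1) bij_betw_shift[of d 2 1] d unfolding V_def s_def by auto
    have "card Q = card {x \<in> V - Q. s 1 x \<in> Q} + card {x \<in> {}. s 1 x \<in> Q} + card {x \<in> Q. s 1 x \<in> Q}"
      by (rule card_vimage_split3[OF fin bij QV]) (use Q(1) V_def in auto)
    then have "card Q = card {x \<in> Q. s 1 x \<in> Q}" using c(2) unfolding E_def by (simp only:) simp
    moreover have "finite Q" using Q(1) finite_subset by blast
    ultimately have "{x \<in> Q. s 1 x \<in> Q} = Q" by (intro card_subset_eq) auto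
    then have "s 1 (s 0 x) \<in> Q" using x unfolding E_def by blast
    then show False using out comm by simp
  qed
  ultimately have "s 1 x \<in> E 0" unfolding E_def by blast
  moreover have "s 1 x \<noteq> x"
    using shift_neq[of d 1 2 x] d x unfolding E_def V_def s_def by simp
  ultimately have "2 \<le> card (E 0)" using card_mono[of "E 0" "{x, s 1 x}"] finE x by auto
  then show False using c by simp
qed

text \<open>For even \<open>d\<close> the number of vertices is even, so a barrier that exhausts the graph has
  an excess of at least two vertices.\<close>

lemma edge_preclusion_even:
  assumes d: "d \<ge> 3" "even d"
    and F: "F \<subseteq> edges (recursive_circulant 2 d)"
    and no: "\<not> has_fractional_perfect_matching (delete_edges (recursive_circulant 2 d) F)"
  shows "4 \<le> card F"
proof (rule ccontr)
  assume "\<not> 4 \<le> card F"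
  then have F3: "card F \<le> 3" by simp
  define G where "G = recursive_circulant 2 d"
  define V where "V = {0..<(int d)\<^sup>2}"
  define s where "s = shift (int d) 2"
  have d0: "d > 0" "int d > 0" "int d \<ge> 3" using d by simp_all
  have finV: "finite V" unfolding V_def by simp
  have vertsV: "verts (delete_edges G F) = V"
    unfolding verts_delete_edges G_def verts_recursive_circulant V_def by simp
  have finH: "finite (verts (delete_edges G F))" using vertsV finV by simp
  have wfH: "\<exists>u v. u \<in> verts (delete_edges G F) \<and> v \<in> verts (delete_edges G F) \<and> u \<noteq> v \<and> e = {u, v}"
    if "e \<in> edges (delete_edges G F)" for e
    using recursive_circulant_edge[OF d(1), of e 2, folded G_def] that
    unfolding vertsV edges_delete_edges V_def by blast
  have noH: "\<not> has_fractional_perfect_matching (delete_edges G F)" using no unfolding G_def .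
  obtain X S where XS: "X \<subseteq> V" "S \<subseteq> V" "X \<inter> S = {}" "card S < card X"
    and bar: "\<And>u v. u \<in> X \<Longrightarrow> {u, v} \<in> edges (delete_edges G F) \<Longrightarrow> v \<in> S"
    using no_fractional_perfect_matching_barrier[OF finH wfH noH] vertsV by metis
  define Q where "Q = V - X - S"
  have VXSQ: "V = X \<union> S \<union> Q" and dis: "X \<inter> S = {}" "X \<inter> Q = {}" "S \<inter> Q = {}"
    using XS unfolding Q_def by auto
  have fin: "finite X" "finite S" "finite Q" using finV VXSQ by auto
  have sV: "s i x \<in> V" for i x unfolding s_def V_def by (rule shift_in[OF d0(2)])
  have bij: "bij_betw (s i) V V" for i unfolding s_def V_def by (rule bij_betw_shift[OF d0(2)])
  have arc_edge: "{x, s i x} \<in> edges G" if "x \<in> V" "i < 2" for x i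
    using that unfolding G_def edges_recursive_circulant[OF d0(1)] V_def s_def by blast
  define m where "m A B i = card {x \<in> A. s i x \<in> B}" for A B i
  have out: "card A = m A X i + m A S i + m A Q i" if "A \<subseteq> V" for A i
    unfolding m_def by (rule card_split3) (use finite_subset[OF that finV] sV VXSQ dis in auto)
  have into: "card A = m X A i + m S A i + m Q A i" if "A \<subseteq> V" for A i
    unfolding m_def by (rule card_vimage_split3[OF finV bij VXSQ dis that])
  have QV: "Q \<subseteq> V" using VXSQ by blast
  define P where "P A B = (SIGMA i:{..<2::nat}. {x \<in> A. s i x \<in> B})" for A B
  have cP: "card (P A B) = m A B 0 + m A B 1" if "finite A" for A B
  proof -
    have "card (P A B) = (\<Sum>i<2. card {x \<in> A. s i x \<in> B})"
      unfolding P_def using that by (intro card_SigmaI) auto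
    then show ?thesis unfolding m_def by (simp add: numeral_2_eq_2)
  qed
  have finP: "finite (P A B)" if "finite A" for A B unfolding P_def using that by auto
  \<comment> \<open>All edges at \<open>X\<close> not leading to \<open>S\<close> are deleted, in
    either orientation; there are at most three.\<close>
  define Z where "Z = P X X \<union> P X Q \<union> P Q X"
  have "(\<lambda>(i, x). {x, s i x}) ` Z \<subseteq> F"
  proof
    fix e assume "e \<in> (\<lambda>(i, x). {x, s i x}) ` Z"
    then obtain i x where e: "e = {x, s i x}" "(i, x) \<in> Z" by auto
    then have "i < 2" "x \<in> V" unfolding Z_def P_def using VXSQ by auto
    then have eG: "e \<in> edges G" using arc_edge e(1) by blast
    show "e \<in> F"
    proof (rule ccontr)
      assume "e \<notin> F"
      then have H: "{x, s i x} \<in> edges (delete_edges G F)" "{s i x, x} \<in> edges (delete_edges G F)"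
        using eG e(1) unfolding edges_delete_edges by (auto simp: insert_commute)
      from e(2) have "x \<in> X \<and> s i x \<notin> S \<or> x \<notin> S \<and> s i x \<in> X"
        unfolding Z_def P_def using dis by blast
      then show False using bar H by blast
    qed
  qed
  moreover have "inj_on (\<lambda>(i, x). {x, s i x}) Z"
    using inj_on_arc_edge[OF d0(3), of 2] unfolding s_def
    by (rule inj_on_subset) (use VXSQ in \<open>auto simp: Z_def P_def V_def\<close>)
  moreover have "finite F" using finite_subset[OF F finite_edges_recursive_circulant[OF d(1)]] .
  ultimately have "card Z \<le> card F" by (metis card_inj_on_le)
  moreover have "card Z = card (P X X) + card (P X Q) + card (P Q X)"
  proof -
    have "card Z = card (P X X \<union> P X Q) + card (P Q X)"
      unfolding Z_def by (rule card_Un_disjoint) (use finP fin dis in \<open>auto simp: P_def\<close>)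
    also have "card (P X X \<union> P X Q) = card (P X X) + card (P X Q)"
      by (rule card_Un_disjoint) (use finP fin dis in \<open>auto simp: P_def\<close>)
    finally show ?thesis .
  qed
  ultimately have del: "m X X 0 + m X X 1 + (m X Q 0 + m X Q 1) + (m Q X 0 + m Q X 1) \<le> 3"
    using F3 cP fin by simp
  note counts = out[OF XS(1), of 0] out[OF XS(1), of 1] into[OF XS(1), of 0] into[OF XS(1), of 1]
    out[OF XS(2), of 0] out[OF XS(2), of 1] into[OF XS(2), of 0] into[OF XS(2), of 1]
    out[OF QV, of 0] out[OF QV, of 1] into[OF QV, of 0] into[OF QV, of 1]
  show False
  proof (cases "Q = {}")
    case True
    then have "card V = card X + card S"
      using VXSQ card_Un_disjoint[OF fin(1,2) dis(1)] by simp
    moreover have "card V = d\<^sup>2" unfolding V_def by (simp flip: of_nat_power)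
    then have "even (card V)" using d(2) by simp
    ultimately have "even (card X + card S)" by (simp only:)
    then have "card X \<noteq> Suc (card S)" by auto
    then have "card X \<ge> card S + 2" using XS(4) by simp
    \<comment> \<open>For each type, arcs leaving \<open>X\<close> minus arcs entering
      \<open>S\<close> give \<open>m X X i \<ge> card X - card S \<ge> 2\<close>, so at least four
      edges are deleted.\<close>
    then show False using counts del by linarith
  next
    case False
    have "X \<noteq> {}" using XS(4) by auto
    then have "Q \<noteq> V" using dis VXSQ by blast
    have "V - Q = X \<union> S" using VXSQ dis by blast
    then have "{x \<in> V - Q. s i x \<in> Q} = {x \<in> X. s i x \<in> Q} \<union> {x \<in> S. s i x \<in> Q}" for i by blast
    then have le: "card {x \<in> V - Q. s i x \<in> Q} \<le> m X Q i + m S Q i" for i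
      unfolding m_def by (simp only: card_Un_le)
    have "2 \<le> (\<Sum>i<2. card {x \<in> V - Q. s i x \<in> Q})"
      using arcs_into_neq_one[OF d0(3), of Q] QV False \<open>Q \<noteq> V\<close> unfolding V_def s_def by simp
    then have "2 \<le> card {x \<in> V - Q. s 0 x \<in> Q} + card {x \<in> V - Q. s 1 x \<in> Q}"
      by (simp add: numeral_2_eq_2)
    then have "2 \<le> m X Q 0 + m S Q 0 + (m X Q 1 + m S Q 1)" using le[of 0] le[of 1] by linarith
    \<comment> \<open>Summed over both types, \<open>XX + XQ \<ge> 2 + QS\<close>, because
      \<open>card X > card S\<close>. As many arcs leave \<open>Q\<close> as enter it, so
      \<open>QX + QS \<ge> 2\<close>, and adding the two gives
      \<open>XX + XQ + QX \<ge> 4\<close>.\<close>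
    then show False using counts del XS(4) by linarith
  qed
qed

section \<open>Precluding sets\<close>

lemma fmp_le:
  assumes "finite F" "F \<subseteq> edges G" "\<not> has_fractional_perfect_matching (delete_edges G F)"
  shows "fmp G \<le> card F"
  unfolding fmp_def by (rule cInf_lower) (use assms in auto)

lemma fsmp_le:
  assumes "finite F" "F \<subseteq> verts G <+> edges G" "\<not> has_fractional_perfect_matching (delete_mixed G F)"
  shows "fsmp G \<le> card F"
  unfolding fsmp_def by (rule cInf_lower) (use assms in auto)

lemma fsmp_le_edges:
  assumes "finite F" "F \<subseteq> edges G" "\<not> has_fractional_perfect_matching (delete_edges G F)"
  shows "fsmp G \<le> card F"
  using fsmp_le[of "Inr ` F" G] assms by (auto simp: delete_mixed_Inr card_image)

text \<open>The witness \<open>F0\<close> rules out the infimum of the empty set, which would be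
  0.\<close>

lemma fsmp_ge:
  assumes "F0 \<subseteq> edges G" "finite F0" "\<not> has_fractional_perfect_matching (delete_edges G F0)"
    and "\<And>F. finite F \<Longrightarrow> F \<subseteq> verts G <+> edges G \<Longrightarrow>
      \<not> has_fractional_perfect_matching (delete_mixed G F) \<Longrightarrow> b \<le> card F"
  shows "b \<le> fsmp G"
  unfolding fsmp_def
proof (rule cInf_greatest)
  have "Inr ` F0 \<subseteq> verts G <+> edges G" "finite (Inr ` F0)"
    "\<not> has_fractional_perfect_matching (delete_mixed G (Inr ` F0))"
    using assms(1-3) by (auto simp: delete_mixed_Inr)
  then show "{card F | F. finite F \<and> F \<subseteq> verts G <+> edges G \<and>
      \<not> has_fractional_perfect_matching (delete_mixed G F)} \<noteq> {}" by blast
qed (use assms(4) in blast)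

lemma fmp_ge:
  assumes "F0 \<subseteq> edges G" "finite F0" "\<not> has_fractional_perfect_matching (delete_edges G F0)"
    and "\<And>F. finite F \<Longrightarrow> F \<subseteq> edges G \<Longrightarrow>
      \<not> has_fractional_perfect_matching (delete_edges G F) \<Longrightarrow> b \<le> card F"
  shows "b \<le> fmp G"
  unfolding fmp_def by (rule cInf_greatest) (use assms in blast)+

lemma fsmp_le_fmp:
  assumes "F0 \<subseteq> edges G" "finite F0" "\<not> has_fractional_perfect_matching (delete_edges G F0)"
  shows "fsmp G \<le> fmp G"
  by (rule fmp_ge[OF assms]) (rule fsmp_le_edges)

text \<open>Vertex 0 has at most one outgoing and one incoming arc of each type. The inequality
  suffices, as the general lower bound supplies the converse.\<close>

lemma isolating_set:
  fixes n d :: nat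
  assumes d: "d \<ge> 3"
  defines "F \<equiv> {e \<in> edges (recursive_circulant n d). 0 \<in> e}"
  shows "finite F" "card F \<le> 2 * n"
    "\<not> has_fractional_perfect_matching (delete_edges (recursive_circulant n d) F)"
proof -
  let ?G = "recursive_circulant n d"
  let ?s = "shift (int d) n"
  have d0: "d > 0" using d by simp
  show finF: "finite F" unfolding F_def using finite_edges_recursive_circulant[OF d] by simp
  have "F \<subseteq> (\<lambda>i. {0, ?s i 0}) ` {..<n} \<union> (\<lambda>i. {- (int d ^ i) mod int d ^ n, 0}) ` {..<n}"
  proof
    fix e assume "e \<in> F"
    then obtain x i where e: "e = {x, ?s i x}" "x \<in> {0..<int d ^ n}" "i < n" "0 \<in> e"
      unfolding F_def edges_recursive_circulant[OF d0] by blast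
    show "e \<in> (\<lambda>i. {0, ?s i 0}) ` {..<n} \<union> (\<lambda>i. {- (int d ^ i) mod int d ^ n, 0}) ` {..<n}"
    proof (cases "x = 0")
      case False
      then have s: "?s i x = 0" using e by auto
      then have "(x + int d ^ i) mod int d ^ n = 0" unfolding shift_def .
      then have "(x + int d ^ i - int d ^ i) mod int d ^ n = (0 - int d ^ i) mod int d ^ n"
        by (metis mod_diff_left_eq)
      then have "x = - (int d ^ i) mod int d ^ n" using e(2) by simp
      then show ?thesis using e s by blast
    qed (use e in blast)
  qed
  then have "card F \<le> card ((\<lambda>i. {0, ?s i 0}) ` {..<n} \<union> (\<lambda>i. {- (int d ^ i) mod int d ^ n, 0}) ` {..<n})"
    by (rule card_mono[rotated]) simp
  also have "\<dots> \<le> card ((\<lambda>i. {0, ?s i 0}) ` {..<n}) + card ((\<lambda>i. {- (int d ^ i) mod int d ^ n, 0}) ` {..<n})"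
    by (rule card_Un_le)
  also have "\<dots> \<le> n + n"
    by (intro add_mono order.trans[OF card_image_le]) simp_all
  finally show "card F \<le> 2 * n" by simp
  show "\<not> has_fractional_perfect_matching (delete_edges ?G F)"
  proof (rule barrier_no_fractional_perfect_matching[where I = "{0}" and S = "{}"])
    show "card (e \<inter> {0}) \<le> card (e \<inter> {})" if "e \<in> edges (delete_edges ?G F)" for e
      using that unfolding edges_delete_edges F_def by auto
  qed (use d0 finite_edges_recursive_circulant[OF d]
      in \<open>auto simp: edges_delete_edges verts_delete_edges verts_recursive_circulant\<close>)
qed

lemma no_fractional_perfect_matching_unbalanced:
  assumes "finite (edges G)" "finite I" "finite S" "verts G = I \<union> S" "card S < card I"
    and wf: "\<And>e. e \<in> edges G \<Longrightarrow> \<exists>u v. u \<in> verts G \<and> v \<in> verts G \<and> u \<noteq> v \<and> e = {u, v}"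
    and indep: "\<And>e. e \<in> edges G \<Longrightarrow> \<not> e \<subseteq> I"
  shows "\<not> has_fractional_perfect_matching G"
proof (rule barrier_no_fractional_perfect_matching[OF assms(1-3) _ _ _ assms(5)])
  fix e assume e: "e \<in> edges G"
  obtain u v where uv: "u \<in> verts G" "v \<in> verts G" "u \<noteq> v" "e = {u, v}" using wf[OF e] by blast
  have *: "card (e \<inter> I) \<le> card (e \<inter> S)" if "e = {a, b}" "a \<notin> I" "a \<in> verts G" for a b
  proof -
    have "card (e \<inter> I) \<le> card {b}" by (rule card_mono) (use that in auto)
    also have "\<dots> = card {a}" by simp
    also have "\<dots> \<le> card (e \<inter> S)" by (rule card_mono) (use that assms(4) in auto)
    finally show ?thesis .
  qed
  show "card (e \<inter> I) \<le> card (e \<inter> S)"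
    using indep[OF e] *[of u v] *[of v u] uv by (auto simp: insert_commute)
qed (use assms(4) in auto)

section \<open>The small exceptional circulants\<close>

text \<open>The differences 1 and 3 are odd, so only arcs wrapping around 9 join vertices of equal
  parity. \<open>I\<close> is the odd vertices and 0: the edge from 7 to 1 wraps, and 0 adds its odd
  neighbours 1 and 3.\<close>

lemma fmp_2_3_le: "fmp (recursive_circulant 2 3) \<le> 3"
proof -
  let ?G = "recursive_circulant 2 3"
  let ?I = "{0, 1, 3, 5, 7} :: int set" and ?S = "{2, 4, 6, 8} :: int set"
  define F where "F = {e \<in> edges ?G. e \<subseteq> ?I}"
  have finF: "finite F" unfolding F_def using finite_edges_recursive_circulant[of 3 2] by simp
  have "F \<subseteq> {{0, 1}, {0, 3}, {7, 1}}"
  proof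
    fix e assume "e \<in> F"
    then obtain x i where e: "e = {x, shift 3 2 i x}" "i < 2" "x \<in> ?I" "shift 3 2 i x \<in> ?I"
      unfolding F_def using edges_recursive_circulant[of 3 2] by auto
    from e(2) consider "i = 0" | "i = 1" by linarith
    then show "e \<in> {{0, 1}, {0, 3}, {7, 1}}"
    proof cases
      case 1
      then have "x = 0" using e(3,4) by (auto simp: shift_def)
      then show ?thesis using e(1) 1 by (simp add: shift_def)
    next
      case 2
      then have "x = 0 \<or> x = 7" using e(3,4) by (auto simp: shift_def)
      then have "e = {0, 3} \<or> e = {7, 1}" unfolding e(1) 2 by (elim disjE) (simp_all add: shift_def)
      then show ?thesis by blast
    qed
  qed
  then have "card F \<le> card {{0, 1}, {0, 3}, {7, 1 :: int}}" by (rule card_mono[rotated]) simp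
  also have "\<dots> \<le> 3" by (simp add: card_insert_if)
  finally have "card F \<le> 3" .
  moreover have "\<not> has_fractional_perfect_matching (delete_edges ?G F)"
  proof (rule no_fractional_perfect_matching_unbalanced[of _ ?I ?S])
    show "verts (delete_edges ?G F) = ?I \<union> ?S"
      unfolding verts_delete_edges verts_recursive_circulant by auto
    show "\<exists>u v. u \<in> verts (delete_edges ?G F) \<and> v \<in> verts (delete_edges ?G F) \<and> u \<noteq> v \<and> e = {u, v}"
      if "e \<in> edges (delete_edges ?G F)" for e
      using that recursive_circulant_edge[of 3 e 2]
      unfolding edges_delete_edges verts_delete_edges verts_recursive_circulant by auto
    show "\<not> e \<subseteq> ?I" if "e \<in> edges (delete_edges ?G F)" for e
      using that unfolding edges_delete_edges F_def by blast
  qed (use finite_edges_recursive_circulant[of 3 2] in \<open>auto simp: edges_delete_edges\<close>)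
  ultimately show ?thesis using fmp_le[OF finF, of ?G] unfolding F_def by fastforce
qed

text \<open>Write a vertex as \<open>4 * q + r\<close>. Even \<open>q\<close> with
  \<open>r \<noteq> 2\<close> and odd \<open>q\<close> with \<open>r = 2\<close> make up
  \<open>I\<close>, half of the 16 vertices. Steps by 4 leave \<open>I\<close>, and unit steps stay
  in it only from \<open>r = 0\<close> to \<open>r = 1\<close>. Deleting these two edges and vertex
  2 of the other half leaves 8 against 7.\<close>

lemma fsmp_2_4_le: "fsmp (recursive_circulant 2 4) \<le> 3"
proof -
  let ?G = "recursive_circulant 2 4"
  let ?I = "{0, 1, 3, 6, 8, 9, 11, 14} :: int set" and ?S = "{4, 5, 7, 10, 12, 13, 15} :: int set"
  define B where "B = {e \<in> edges ?G. e \<subseteq> ?I}"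
  define F where "F = {2 :: int} <+> B"
  have finB: "finite B" unfolding B_def using finite_edges_recursive_circulant[of 4 2] by simp
  have "B \<subseteq> {{0, 1}, {8, 9}}"
  proof
    fix e assume "e \<in> B"
    then obtain x i where e: "e = {x, shift 4 2 i x}" "i < 2" "x \<in> ?I" "shift 4 2 i x \<in> ?I"
      unfolding B_def using edges_recursive_circulant[of 4 2] by auto
    from e(2) consider "i = 0" | "i = 1" by linarith
    then show "e \<in> {{0, 1}, {8, 9}}"
    proof cases
      case 1
      then have "x = 0 \<or> x = 8" using e(3,4) by (auto simp: shift_def)
      then have "e = {0, 1} \<or> e = {8, 9}" unfolding e(1) 1 by (elim disjE) (simp_all add: shift_def)
      then show ?thesis by blast
    next
      case 2
      then have False using e(3,4) by (auto simp: shift_def)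
      then show ?thesis ..
    qed
  qed
  then have "card B \<le> card {{0, 1}, {8, 9 :: int}}" by (rule card_mono[rotated]) simp
  also have "\<dots> \<le> 2" by (simp add: card_insert_if)
  finally have "card F \<le> 3" unfolding F_def using finB by (simp add: card_Plus)
  have "x \<in> {0..<16} - {2} \<longleftrightarrow> x \<in> ?I \<union> ?S" for x :: int
    unfolding insert_iff Un_iff Diff_iff atLeastLessThan_iff empty_iff by presburger
  then have "{0..<16} - {2} = ?I \<union> ?S" by (rule set_eqI)
  moreover have "verts (delete_mixed ?G F) = {0..<16} - {2}"
    unfolding verts_delete_mixed verts_recursive_circulant F_def by auto
  ultimately have verts: "verts (delete_mixed ?G F) = ?I \<union> ?S" by (simp only:)
  have edges: "edges (delete_mixed ?G F) = {e \<in> edges ?G - B. 2 \<notin> e}"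
    unfolding edges_delete_mixed F_def by auto
  have "\<not> has_fractional_perfect_matching (delete_mixed ?G F)"
  proof (rule no_fractional_perfect_matching_unbalanced[OF _ _ _ verts])
    show "\<exists>u v. u \<in> verts (delete_mixed ?G F) \<and> v \<in> verts (delete_mixed ?G F) \<and> u \<noteq> v \<and> e = {u, v}"
      if e: "e \<in> edges (delete_mixed ?G F)" for e
    proof -
      obtain u v where uv: "u \<in> {0..<int 4 ^ 2}" "v \<in> {0..<int 4 ^ 2}" "u \<noteq> v" "e = {u, v}"
        using recursive_circulant_edge[of 4 e 2] e unfolding edges by auto
      moreover have "u \<noteq> 2" "v \<noteq> 2" using e uv(4) unfolding edges by auto
      ultimately show ?thesis
        unfolding verts_delete_mixed verts_recursive_circulant F_def by auto
    qed
    show "\<not> e \<subseteq> ?I" if "e \<in> edges (delete_mixed ?G F)" for e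
      using that unfolding edges B_def by blast
  qed (use finite_edges_recursive_circulant[of 4 2] in \<open>auto simp: edges\<close>)
  moreover have "F \<subseteq> verts ?G <+> edges ?G" unfolding F_def B_def verts_recursive_circulant by auto
  moreover have "finite F" unfolding F_def using finB by simp
  ultimately show ?thesis using fsmp_le \<open>card F \<le> 3\<close> order_trans by blast
qed

theorem theorem4p21:
  fixes n d :: nat
  assumes "n \<ge> 2" and "d \<ge> 3"
  shows "fmp (recursive_circulant n d) = (if (n, d) = (2, 3) then 3 else 2 * n) \<and>
         fsmp (recursive_circulant n d) = (if (n, d) \<in> {(2, 3), (2, 4)} then 3 else 2 * n)"
proof -
  let ?G = "recursive_circulant n d"
  define F0 where "F0 = {e \<in> edges ?G. 0 \<in> e}"
  have F0: "F0 \<subseteq> edges ?G" "finite F0" "\<not> has_fractional_perfect_matching (delete_edges ?G F0)"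
    "card F0 \<le> 2 * n"
    using isolating_set[OF assms(2), of n] unfolding F0_def by auto
  note witness = F0(1-3)
  have fmp_le_2n: "fmp ?G \<le> 2 * n" using fmp_le[OF F0(2,1,3)] F0(4) by simp
  have le: "fsmp ?G \<le> fmp ?G" by (rule fsmp_le_fmp[OF witness])
  \<comment> \<open>\<open>Suc b\<close> is 3 for the two small circulants and \<open>2 * n\<close>
    otherwise.\<close>
  define b :: nat where "b = (if n = 2 \<and> d < 5 then 2 else 2 * n - 1)"
  have "Suc b \<le> fsmp ?G"
  proof (rule fsmp_ge[OF witness], rule Suc_leI)
    fix F assume F: "finite F" "F \<subseteq> verts ?G <+> edges ?G"
      "\<not> has_fractional_perfect_matching (delete_mixed ?G F)"
    show "b < card F"
    proof (rule preclusion_lower_bound[OF assms(2) _ F])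
      fix X assume "X \<subseteq> {0..<int d ^ n}" "X \<noteq> {}"
      then show "2 * card X + b \<le> card (closed_nbhd (int d) n X) + inner_arcs (int d) n X"
        using closed_nbhd_expansion[of "int d" n X] assms unfolding b_def by (auto split: if_splits)
    qed
  qed
  then have ge: "fsmp ?G \<ge> (if n = 2 \<and> d < 5 then 3 else 2 * n)"
    using assms(1) unfolding b_def by (auto split: if_splits)
  consider "n = 2" "d = 3" | "n = 2" "d = 4" | "\<not> (n = 2 \<and> d < 5)" using assms(2) by linarith
  then show ?thesis
  proof cases
    case 1
    then show ?thesis using ge le fmp_2_3_le by simp
  next
    case 2
    have "4 \<le> fmp ?G"
    proof (rule fmp_ge[OF witness])
      show "4 \<le> card F" if "F \<subseteq> edges ?G" "\<not> has_fractional_perfect_matching (delete_edges ?G F)" for F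
        using edge_preclusion_even[of d F] that 2 by simp
    qed
    then show ?thesis using 2 ge fmp_le_2n fsmp_2_4_le by simp
  next
    case 3
    then show ?thesis using ge le fmp_le_2n assms(2) by auto
  qed
qed

end
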